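(* Let $r$ be a rational function of degree $d\ge 2$ with $n$ distinct poles in $\widehat{\mathbb C}$. Then $\widehat F_r\le\min\{3d+2n-3,\,5d-5\}$.
   Context: $\widehat F_r$ denotes the number of distinct solutions in $\widehat{\mathbb C}$ (including $\infty$ when $r(\infty)=\infty$) of the equation $r(z)=\bar z$, i.e. the number of fixed points of $z\mapsto\overline{r(z)}$ on the Riemann sphere. *)

theory Defs
  imports "HOL-Analysis.Analysis" "HOL-Computational_Algebra.Polynomial"
begin

text \<open>A rational function r on the Riemann sphere is represented in lowest terms as
  r = p / q with p, q complex polynomials, q nonzero and p, q coprime.\<close>

definition is_rat_repr :: "complex poly \<Rightarrow> complex poly \<Rightarrow> bool" where
  "is_rat_repr p q \<longleftrightarrow> q \<noteq> 0 \<and> coprime p q"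

definition rat_degree :: "complex poly \<Rightarrow> complex poly \<Rightarrow> nat" where
  "rat_degree p q = max (degree p) (degree q)"

definition pole_at_infinity :: "complex poly \<Rightarrow> complex poly \<Rightarrow> bool" where
  "pole_at_infinity p q \<longleftrightarrow> degree p > degree q"

definition num_poles :: "complex poly \<Rightarrow> complex poly \<Rightarrow> nat" where
  "num_poles p q = card {z. poly q z = 0} + (if pole_at_infinity p q then 1 else 0)"

definition finite_fixed_pts :: "complex poly \<Rightarrow> complex poly \<Rightarrow> complex set" where
  "finite_fixed_pts p q = {z. poly q z \<noteq> 0 \<and> poly p z / poly q z = cnj z}"

text \<open>Fhat_r: number of solutions of r(z) = conj z in the Riemann sphere,
  counting infinity when r(infinity) = infinity.\<close>
definition F_hat :: "complex poly \<Rightarrow> complex poly \<Rightarrow> nat" where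
  "F_hat p q = card (finite_fixed_pts p q) + (if pole_at_infinity p q then 1 else 0)"

end

theory Submission
  imports Defs "HOL-Complex_Analysis.Complex_Analysis"
    "HOL-Computational_Algebra.Fundamental_Theorem_Algebra" "HOL-Real_Asymp.Real_Asymp"
begin

text \<open>
  The argument is that of Khavinson and Neumann. A fixed point of \<open>g z = cnj (r z)\<close> is attracting,
  neutral or repelling according to the size of \<open>r'\<close> there. By Fatou's theorem every non-repelling
  fixed point attracts a critical value of \<open>g\<close>, so there are at most \<open>K\<close> of them, where \<open>K\<close> is the
  number of critical values. If no fixed point is neutral, the argument principle for
  \<open>z - cnj (r z)\<close> says that there are \<open>d - 1\<close> more repelling than attracting fixed points.
  Adding a small constant to \<open>r\<close> destroys the neutral fixed points (Sard), keeps the repelling ones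
  and does not change \<open>K\<close>; hence there are at most \<open>2 K + d - 1\<close> fixed points altogether. Finally
  \<open>K \<le> 2 d - 2\<close>, and \<open>K \<le> d + n - 1\<close> because all critical poles share the critical value infinity.

  Fatou's theorem is proved for a map that has another fixed point at infinity. Take an attracting
  disc or, at a neutral point, an attracting petal in the coordinate in which \<open>g \<circ> g\<close> is close to
  a translation. If the basin contained no critical value, the inverse branches of all iterates of
  \<open>g \<circ> g\<close> would be univalent on it and omit a fixed value, while they spread two orbit points
  apart whose distance, relative to the distance to the boundary, tends to zero. This contradicts
  Schottky's theorem.
\<close>

text \<open>Normalising infinity to be a fixed point serves several ends. Adding a constant to the
  map keeps infinity fixed with the same multiplier, so the perturbed map has the same form. If
  infinity is moreover repelling, then z dominates \<open>cnj (r z)\<close> for large z, and the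
  winding number at infinity is known. The index count is therefore used only when some finite fixed
  point is repelling and can be moved to infinity. If none is, any finite fixed point is moved
  there: the bound for non-repelling points alone, plus two exceptional points, is already small
  enough for degree at least 2. Fatou's theorem needs only discs and petals: the multiplier of the
  second iterate at a fixed point is the square of the norm of \<open>r'\<close>, so a neutral point
  has multiplier exactly 1. Both cases go through one theorem about a self-map of a convex open set,
  conjugate to the second iterate.\<close>

section \<open>A Lipschitz bound for univalent functions omitting a value\<close>

text \<open>As \<open>f\<close> is injective, a square root \<open>h\<close> of \<open>(f - a) / (f w - a)\<close> never takes the value \<open>- h w\<close>,
  so it omits two values and Schottky's theorem applies.\<close>

lemma univalent_omitting_Lipschitz:
  obtains M :: real where "M > 0"
    "\<And>f w \<rho> a t. \<lbrakk>f holomorphic_on ball w \<rho>; inj_on f (ball w \<rho>); a \<notin> f ` ball w \<rho>;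
        \<rho> > 0; dist w t < \<rho> / 4\<rbrakk> \<Longrightarrow> norm (f t - f w) \<le> M * norm (f w - a) * (dist w t / \<rho>)"
proof -
  \<comment> \<open>Schottky's bound on the disc of radius 1/2 for a function whose value at 0 has
    norm at most 1. It is independent of \<open>f\<close>, \<open>w\<close>, \<open>\<rho>\<close>
    and \<open>a\<close>, which makes the final constant uniform.\<close>
  define N :: real where "N = exp(pi * exp(pi * (2 + 2 * 1 + 12 * (1/2) / (1 - 1/2))))"
  have "norm (f t - f w) \<le> 8 * (N\<^sup>2 + 1) * norm (f w - a) * (dist w t / \<rho>)"
    if hol: "f holomorphic_on ball w \<rho>" and inj: "inj_on f (ball w \<rho>)" and a: "a \<notin> f ` ball w \<rho>"
      and \<rho>: "\<rho> > 0" and t: "dist w t < \<rho> / 4" for f :: "complex \<Rightarrow> complex" and w \<rho> a t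
  proof -
    have aw: "f w - a \<noteq> 0" using a \<rho> by auto
    \<comment> \<open>The scale \<open>\<rho>/2\<close> turns the given disc into one of radius 2,
      so that the closed unit disc of Schottky's theorem lies inside.\<close>
    define F where "F = (\<lambda>z. f (w + of_real (\<rho>/2) * z))"
    have in_ball: "w + of_real (\<rho>/2) * z \<in> ball w \<rho>" if "z \<in> ball 0 2" for z :: complex
      using that \<rho> by (auto simp: dist_norm norm_mult)
    have holF: "F holomorphic_on ball 0 2"
      unfolding F_def
      by (rule holomorphic_on_compose_gen[OF _ hol, unfolded o_def])
         (use in_ball in \<open>auto intro!: holomorphic_intros\<close>)
    have nz: "(F z - a) / (f w - a) \<noteq> 0" if "z \<in> ball 0 2" for z
      using a in_ball[OF that] aw by (auto simp: F_def)
    have F0: "F 0 = f w" by (simp add: F_def)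
    have "(\<lambda>z. (F z - a) / (f w - a)) holomorphic_on ball 0 2"
      using aw by (intro holomorphic_intros holF) auto
    then obtain h where holh: "h holomorphic_on ball 0 2"
        and h: "\<And>z. z \<in> ball 0 2 \<Longrightarrow> (F z - a) / (f w - a) = (h z)\<^sup>2"
      by (rule contractible_imp_holomorphic_sqrt[OF _ convex_imp_contractible[OF convex_ball]])
        (use nz in blast)+
    have h0: "(h 0)\<^sup>2 = 1" using h[of 0] F0 aw by simp
    then have h0': "h 0 \<noteq> 0" and nh0: "norm (h 0) = 1"
      by (auto simp: power2_eq_1_iff)
    define k where "k = (\<lambda>z. - h z / h 0)"
    have sub: "cball 0 1 \<subseteq> ball (0::complex) 2" by auto
    have holk: "k holomorphic_on cball 0 1"
      unfolding k_def using holomorphic_on_subset[OF holh sub] h0' by (auto intro!: holomorphic_intros)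
    have no: "\<not> (k z = 0 \<or> k z = 1)" if "z \<in> cball 0 1" for z
    proof -
      have z2: "z \<in> ball 0 2" using that by auto
      have "h z \<noteq> 0" using nz[OF z2] h[OF z2] by auto
      moreover have "k z \<noteq> 1"
      proof
        assume "k z = 1"
        then have "- h z = h 0" using h0' by (simp add: k_def field_simps)
        then have hz: "h z = - h 0" by (metis minus_minus)
        then have "(h z)\<^sup>2 = 1" using h0 by simp
        then have "F z = F 0" using h[OF z2] aw F0 by (simp add: field_simps)
        then have "w + of_real (\<rho>/2) * z = w"
          using inj_onD[OF inj _ in_ball[OF z2]] \<rho> by (auto simp: F_def)
        then have "z = 0" using \<rho> by simp
        then show False using hz h0' by simp
      qed
      ultimately show ?thesis using h0' by (auto simp: k_def)
    qed
    have bnd: "norm (F z - f w) \<le> (N\<^sup>2 + 1) * norm (f w - a)" if "norm z \<le> 1/2" for z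
    proof -
      have z2: "z \<in> ball 0 2" using that by auto
      have "norm (k z) \<le> N"
        unfolding N_def by (rule Schottky[OF holk _ no]) (use that nh0 in \<open>auto simp: k_def norm_divide\<close>)
      then have "norm (h z) \<le> N" using nh0 by (simp add: k_def norm_divide)
      then have "norm ((F z - a) / (f w - a)) \<le> N\<^sup>2"
        unfolding h[OF z2] by (simp add: norm_power power_mono)
      then have "norm (F z - a) \<le> N\<^sup>2 * norm (f w - a)"
        using aw by (simp add: norm_divide field_simps)
      moreover have "norm (F z - f w) \<le> norm (F z - a) + norm (f w - a)"
        by (metis add_diff_cancel_left diff_add_cancel norm_triangle_ineq4 diff_diff_eq2 diff_add_eq)
      ultimately show ?thesis by (simp add: algebra_simps)
    qed
    define B where "B = 2 * (N\<^sup>2 + 1) * norm (f w - a)"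
    have Bpos: "B > 0" using aw by (simp add: B_def add_nonneg_pos)
    \<comment> \<open>Schottky gives mere boundedness on the half disc. Schwarz's lemma turns it
      into a bound linear in the distance; the factor 2 in \<open>B\<close> makes the inequality
      \<open>norm (G z) < 1\<close> strict.\<close>
    define G where "G = (\<lambda>z. (F (z/2) - f w) / of_real B)"
    have holG: "G holomorphic_on ball 0 1"
      unfolding G_def using Bpos
      by (intro holomorphic_intros holomorphic_on_compose_gen[OF _ holF, unfolded o_def]) auto
    define \<xi> where "\<xi> = (t - w) * of_real (4 / \<rho>)"
    have n\<xi>: "norm \<xi> = 4 * dist w t / \<rho>" using \<rho> unfolding \<xi>_def norm_mult dist_norm norm_of_real
      by (simp add: norm_minus_commute)
    have "norm (G \<xi>) \<le> norm \<xi>"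
    proof (rule Schwarz_Lemma(1)[OF holG])
      show "G 0 = 0" by (simp add: G_def F0)
      show "norm (G z) < 1" if "norm z < 1" for z
      proof -
        have "norm (F (z/2) - f w) \<le> B / 2" using bnd[of "z/2"] that by (simp add: B_def algebra_simps)
        then show ?thesis using Bpos by (simp add: G_def norm_divide field_simps)
      qed
      show "norm \<xi> < 1" unfolding n\<xi> using t \<rho> by (simp add: field_simps)
    qed
    have "w + of_real (\<rho>/2) * (\<xi>/2) = t" using \<rho> by (simp add: \<xi>_def field_simps)
    with \<open>norm (G \<xi>) \<le> norm \<xi>\<close> have "norm (G \<xi>) \<le> norm \<xi> \<and> F (\<xi>/2) = f t" by (simp add: F_def)
    then have "norm (f t - f w) \<le> B * (4 * dist w t / \<rho>)"
      using Bpos n\<xi> by (auto simp: G_def norm_divide field_simps)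
    then show ?thesis by (simp add: B_def algebra_simps)
  qed
  moreover have "8 * (N\<^sup>2 + 1) > 0" by (simp add: add_nonneg_pos)
  ultimately show ?thesis using that by blast
qed

section \<open>Rational functions fixing infinity as covering maps\<close>

definition rat :: "complex poly \<Rightarrow> complex poly \<Rightarrow> complex \<Rightarrow> complex" where
  "rat P S z = poly P z / poly S z"

definition wronskian :: "complex poly \<Rightarrow> complex poly \<Rightarrow> complex poly" where
  "wronskian P S = pderiv P * S - P * pderiv S"

text \<open>When infinity is fixed, critical poles and infinity itself only have the critical value
  infinity, so these are all the finite critical values.\<close>

definition crit_vals :: "complex poly \<Rightarrow> complex poly \<Rightarrow> complex set" where
  "crit_vals P S = rat P S ` {z. poly S z \<noteq> 0 \<and> poly (wronskian P S) z = 0}"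

lemma rat_has_field_derivative:
  assumes "poly S z \<noteq> 0"
  shows "(rat P S has_field_derivative poly (wronskian P S) z / (poly S z)\<^sup>2) (at z)"
proof -
  have "((\<lambda>z. poly P z / poly S z) has_field_derivative
      (poly (pderiv P) z * poly S z - poly P z * poly (pderiv S) z) / (poly S z * poly S z)) (at z)"
    by (intro DERIV_divide poly_DERIV assms)
  then show ?thesis
    by (simp add: rat_def[abs_def] wronskian_def power2_eq_square)
qed

lemma deriv_rat: "poly S z \<noteq> 0 \<Longrightarrow> deriv (rat P S) z = poly (wronskian P S) z / (poly S z)\<^sup>2"
  by (rule DERIV_imp_deriv[OF rat_has_field_derivative])

lemma open_poly_nonzero: "open {z. poly (S :: complex poly) z \<noteq> 0}"
  by (intro open_Collect_neq continuous_intros)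

lemma rat_holomorphic: "rat P S holomorphic_on {z. poly S z \<noteq> 0}"
  by (rule holomorphic_on_open[OF open_poly_nonzero, THEN iffD2]) (blast intro: rat_has_field_derivative)

lemma rat_continuous: "(\<And>z. z \<in> X \<Longrightarrow> poly S z \<noteq> 0) \<Longrightarrow> continuous_on X (rat P S)"
  by (rule continuous_on_subset[OF holomorphic_on_imp_continuous_on[OF rat_holomorphic[of P S]]]) auto

lemma coprime_poly_common_root:
  assumes "coprime (P :: complex poly) S" "poly P z = 0" "poly S z = 0"
  shows False
proof -
  have "[:-z, 1:] dvd P" "[:-z, 1:] dvd S" using assms by (simp_all add: poly_eq_0_iff_dvd)
  then have "is_unit [:-z, 1:]" using assms(1) by (meson coprime_common_divisor)
  then show False by (simp add: is_unit_iff_degree)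
qed

lemma poly_exists_root: "degree (P :: complex poly) > 0 \<Longrightarrow> \<exists>z. poly P z = 0"
  using fundamental_theorem_of_algebra[of P] constant_degree[of P] by auto

locale rat_fix_inf =
  fixes P S :: "complex poly"
  assumes cop: "coprime P S" and S_nz: "S \<noteq> 0" and deg_less: "degree S < degree P"
begin

abbreviation r where "r \<equiv> rat P S"

lemma P_nz: "P \<noteq> 0"
  using deg_less by auto

text \<open>The two products have leading coefficients proportional to the degrees of
  \<open>P\<close> and \<open>S\<close>. These differ, so the top terms do not cancel.\<close>

lemma wronskian_degree:
  "wronskian P S \<noteq> 0" "degree (wronskian P S) = degree P + degree S - 1"
proof -
  define d s where "d = degree P" and "s = degree S"
  have ds: "s < d" using deg_less by (simp add: d_def s_def)
  have dP: "degree (pderiv P) = d - 1" by (simp add: degree_pderiv d_def)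
  have 1: "coeff (pderiv P * S) (d + s - 1) = of_nat d * lead_coeff P * lead_coeff S"
  proof -
    have "coeff (pderiv P * S) (degree (pderiv P) + degree S) = lead_coeff (pderiv P) * lead_coeff S"
      by (rule coeff_mult_degree_sum)
    then show ?thesis using ds by (simp add: dP s_def[symmetric] coeff_pderiv d_def)
  qed
  have 2: "coeff (P * pderiv S) (d + s - 1) = of_nat s * lead_coeff P * lead_coeff S"
  proof (cases "s = 0")
    case True
    then have "pderiv S = 0" by (simp add: pderiv_eq_0_iff s_def)
    then show ?thesis using True by simp
  next
    case False
    have "coeff (P * pderiv S) (degree P + degree (pderiv S)) = lead_coeff P * lead_coeff (pderiv S)"
      by (rule coeff_mult_degree_sum)
    moreover have "degree (pderiv S) = s - 1" by (simp add: degree_pderiv s_def)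
    ultimately show ?thesis using False by (simp add: coeff_pderiv d_def s_def)
  qed
  have "coeff (wronskian P S) (d + s - 1) = (of_nat d - of_nat s) * lead_coeff P * lead_coeff S"
    using 1 2 by (simp add: wronskian_def algebra_simps)
  then have nz: "coeff (wronskian P S) (d + s - 1) \<noteq> 0"
    using ds P_nz S_nz by simp
  then show "wronskian P S \<noteq> 0" by auto
  have "degree (pderiv P * S) \<le> d + s - 1"
    using degree_mult_le[of "pderiv P" S] dP ds by (simp add: s_def)
  moreover have "degree (P * pderiv S) \<le> d + s - 1"
  proof (cases "s = 0")
    case True
    then have "pderiv S = 0" by (simp add: pderiv_eq_0_iff s_def)
    then show ?thesis by simp
  next
    case False
    then show ?thesis
      using degree_mult_le[of P "pderiv S"] by (simp add: degree_pderiv s_def d_def)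
  qed
  ultimately have "degree (wronskian P S) \<le> d + s - 1"
    unfolding wronskian_def by (rule degree_diff_le)
  with nz show "degree (wronskian P S) = degree P + degree S - 1"
    using le_degree[of "wronskian P S" "d + s - 1"] by (simp add: d_def s_def)
qed

lemma finite_crit_vals: "finite (crit_vals P S)"
proof -
  have "finite {z. poly (wronskian P S) z = 0}" using poly_roots_finite wronskian_degree by blast
  then show ?thesis unfolding crit_vals_def by (rule finite_imageI[OF finite_subset[rotated]]) auto
qed

lemma fibre_iff: "poly S z \<noteq> 0 \<and> r z = x \<longleftrightarrow> poly (P - smult x S) z = 0"
proof -
  have "poly S z \<noteq> 0" if "poly (P - smult x S) z = 0"
    using coprime_poly_common_root[OF cop, of z] that by auto
  then show ?thesis by (auto simp: rat_def field_simps)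
qed

lemma degree_fibre_poly: "degree (P - smult x S) = degree P"
proof (cases "x = 0")
  case False
  then show ?thesis using degree_add_eq_left[of "- smult x S" P] deg_less by simp
qed simp

lemma finite_fibre: "finite {z. poly (P - smult x S) z = 0}"
  using degree_fibre_poly[of x] deg_less by (intro poly_roots_finite) auto

lemma r_at_infinity: "filterlim r at_infinity at_infinity"
proof -
  have "((\<lambda>x. poly S x / poly P x) \<longlongrightarrow> 0) at_infinity"
    by (rule poly_divide_tendsto_0_at_infinity[OF deg_less])
  moreover have "\<forall>\<^sub>F x in at_infinity. poly S x / poly P x \<noteq> 0"
  proof -
    have "finite {x. poly (S * P) x = 0}" using S_nz P_nz by (intro poly_roots_finite) simp
    then obtain B where "\<forall>x\<in>{x. poly (S * P) x = 0}. norm x \<le> B"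
      using finite_imp_bounded bounded_iff by metis
    then show ?thesis
      by (intro eventually_at_infinityI[of "B+1"]) force
  qed
  ultimately have "filterlim (\<lambda>x. poly S x / poly P x) (at 0) at_infinity"
    by (simp add: filterlim_at)
  then have "filterlim (\<lambda>x. inverse (poly S x / poly P x)) at_infinity at_infinity"
    by (rule filterlim_compose[OF filterlim_inverse_at_infinity])
  then show ?thesis by (simp add: rat_def[abs_def])
qed

text \<open>This is properness of \<open>r\<close>: points with values close to \<open>x\<close>
  cannot escape to infinity, where \<open>r\<close> tends to infinity, and every limit of such
  points solves the fibre equation.\<close>

lemma fibres_near:
  assumes U: "open U" "{z. poly (P - smult x S) z = 0} \<subseteq> U"
  obtains \<delta> where "\<delta> > 0" "\<And>z. \<lbrakk>poly S z \<noteq> 0; dist (r z) x < \<delta>\<rbrakk> \<Longrightarrow> z \<in> U"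
proof -
  have "\<exists>\<delta>>0. \<forall>z. poly S z \<noteq> 0 \<and> dist (r z) x < \<delta> \<longrightarrow> z \<in> U"
  proof (rule ccontr)
    assume "\<not> ?thesis"
    then have "\<forall>n::nat. \<exists>z. poly S z \<noteq> 0 \<and> dist (r z) x < inverse (Suc n) \<and> z \<notin> U"
      by (metis inverse_positive_iff_positive of_nat_0_less_iff zero_less_Suc)
    then obtain z where z: "\<And>n. poly S (z n) \<noteq> 0" "\<And>n. dist (r (z n)) x < inverse (real (Suc n))" "\<And>n. z n \<notin> U"
      by metis
    have rz: "(\<lambda>n. r (z n)) \<longlonglongrightarrow> x"
      by (rule metric_tendsto_imp_tendsto[OF LIMSEQ_inverse_real_of_nat])
         (use z(2) in \<open>auto intro!: always_eventually less_imp_le simp: dist_real_def\<close>)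
    have "\<forall>\<^sub>F w in at_infinity. norm (r w) \<ge> norm x + 1"
      using r_at_infinity by (simp add: filterlim_at_infinity[of 0])
        (metis add.commute add_strict_increasing norm_ge_zero zero_less_one)
    then obtain B where B: "\<And>w. norm w \<ge> B \<Longrightarrow> norm (r w) \<ge> norm x + 1"
      unfolding eventually_at_infinity by blast
    have "norm (z n) \<le> B" for n
    proof (rule ccontr)
      assume "\<not> norm (z n) \<le> B"
      then have "norm (r (z n)) \<ge> norm x + 1" using B by auto
      moreover have "norm (r (z n)) \<le> norm x + dist (r (z n)) x"
        by (metis dist_norm norm_triangle_sub)
      moreover have "inverse (real (Suc n)) \<le> 1" by (simp add: inverse_le_1_iff)
      ultimately show False using z(2)[of n] by linarith
    qed
    then have "bounded (range z)" by (auto simp: bounded_iff)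
    then obtain l s where s: "strict_mono (s::nat\<Rightarrow>nat)" "(z \<circ> s) \<longlonglongrightarrow> l"
      using bounded_imp_convergent_subsequence by metis
    \<comment> \<open>With the denominator cleared, the limit makes sense even if \<open>l\<close>
      is a pole.\<close>
    have "(\<lambda>n. poly P (z (s n)) - r (z (s n)) * poly S (z (s n))) \<longlonglongrightarrow> poly P l - x * poly S l"
      using s(2) LIMSEQ_subseq_LIMSEQ[OF rz s(1)] unfolding o_def by (intro tendsto_intros)
    moreover have "poly P (z (s n)) - r (z (s n)) * poly S (z (s n)) = 0" for n
      using z(1) by (simp add: rat_def)
    ultimately have "poly P l - x * poly S l = 0" by (simp add: LIMSEQ_const_iff)
    then have "l \<in> U" using U(2) by auto
    moreover have "l \<in> - U"
      using closed_sequentially[of "-U" "z \<circ> s" l] U(1) s(2) z(3) by auto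
    ultimately show False by blast
  qed
  then show ?thesis using that by blast
qed

text \<open>Over a non-critical value the fibre is finite and \<open>r\<close> is injective on a
  disc around each of its points. Properness ensures that no further sheet comes near.\<close>

lemma covering_space_r:
  "covering_space {z. poly S z \<noteq> 0 \<and> r z \<notin> crit_vals P S} r (- crit_vals P S)"
  (is "covering_space ?C r ?V")
proof (rule covering_spaceI)
  show "continuous_on ?C r" by (rule rat_continuous) auto
  have openV: "open ?V" using finite_crit_vals by (simp add: finite_imp_closed open_Compl)
  have "\<exists>z. poly S z \<noteq> 0 \<and> r z = x" for x
    using poly_exists_root[of "P - smult x S"] degree_fibre_poly[of x] deg_less fibre_iff by auto
  then show "r ` ?C = ?V" by (auto simp: image_iff) metis
  have openC: "open ?C"
  proof -
    have "open ({z. poly S z \<noteq> 0} \<inter> r -` ?V)"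
      by (rule continuous_open_preimage[OF rat_continuous open_poly_nonzero openV]) simp
    then show ?thesis by (simp add: vimage_def Int_def)
  qed
  fix x assume x: "x \<in> ?V"
  define Y where "Y = {z. poly (P - smult x S) z = 0}"
  have finY: "finite Y" unfolding Y_def by (rule finite_fibre)
  have Y: "poly S y \<noteq> 0" "r y = x" if "y \<in> Y" for y
    using that fibre_iff[of y x] by (auto simp: Y_def)
  have "\<exists>e>0. ball y e \<subseteq> {z. poly S z \<noteq> 0} \<and> inj_on r (ball y e) \<and> (\<forall>y'\<in>Y. y' \<noteq> y \<longrightarrow> 2 * e \<le> dist y y')"
    if y: "y \<in> Y" for y
  proof -
    have "poly (wronskian P S) y \<noteq> 0" using x Y[OF y] by (auto simp: crit_vals_def)
    then have "deriv r y \<noteq> 0" using deriv_rat[of S y P] Y[OF y] by simp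
    then obtain e1 where e1: "e1 > 0" "ball y e1 \<subseteq> {z. poly S z \<noteq> 0}" "inj_on r (ball y e1)"
      using has_complex_derivative_locally_injective[OF rat_holomorphic _ open_poly_nonzero] Y(1)[OF y]
      by (metis mem_Collect_eq)
    obtain e2 where e2: "e2 > 0" "\<forall>x\<in>Y. x \<noteq> y \<longrightarrow> e2 \<le> dist y x"
      using finite_set_avoid[OF finY] by blast
    have "ball y (min e1 (e2/2)) \<subseteq> ball y e1" by auto
    then show ?thesis using e1 e2
      by (intro exI[of _ "min e1 (e2/2)"]) (auto intro: inj_on_subset)
  qed
  then obtain e where e: "\<And>y. y \<in> Y \<Longrightarrow> e y > 0" "\<And>y. y \<in> Y \<Longrightarrow> ball y (e y) \<subseteq> {z. poly S z \<noteq> 0}"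
     "\<And>y. y \<in> Y \<Longrightarrow> inj_on r (ball y (e y))" "\<And>y y'. y \<in> Y \<Longrightarrow> y' \<in> Y \<Longrightarrow> y' \<noteq> y \<Longrightarrow> 2 * e y \<le> dist y y'"
    by metis
  define B where "B = (\<lambda>y. ball y (e y))"
  have disjB: "B y \<inter> B y' = {}" if "y \<in> Y" "y' \<in> Y" "y \<noteq> y'" for y y'
  proof (rule ccontr)
    assume "B y \<inter> B y' \<noteq> {}"
    then obtain z where "dist y z < e y" "dist y' z < e y'" by (auto simp: B_def)
    then have "dist y y' < e y + e y'" using dist_triangle2[of y y' z] by linarith
    moreover have "2 * e y \<le> dist y y'" "2 * e y' \<le> dist y y'"
      using e(4)[of y y'] e(4)[of y' y] that by (auto simp: dist_commute)
    ultimately show False by linarith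
  qed
  have BS: "poly S z \<noteq> 0" if "y \<in> Y" "z \<in> B y" for y z
    using e(2)[OF that(1)] that(2) unfolding B_def by blast
  have contB: "continuous_on (B y) r" if "y \<in> Y" for y
    by (rule rat_continuous) (use BS that in blast)
  obtain \<delta> where \<delta>: "\<delta> > 0" "\<And>z. \<lbrakk>poly S z \<noteq> 0; dist (r z) x < \<delta>\<rbrakk> \<Longrightarrow> z \<in> (\<Union>y\<in>Y. B y)"
  proof (rule fibres_near[of "\<Union>y\<in>Y. B y" x])
    show "open (\<Union>y\<in>Y. B y)" by (auto simp: B_def)
    show "{z. poly (P - smult x S) z = 0} \<subseteq> (\<Union>y\<in>Y. B y)"
      using e(1) by (force simp: B_def Y_def)
  qed auto
  \<comment> \<open>The images make each disc cover all of \<open>T\<close>; the ball of radius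
    \<open>\<delta>\<close> confines all preimages of \<open>T\<close> to the discs.\<close>
  define T where "T = ball x \<delta> \<inter> ?V \<inter> (\<Inter>y\<in>Y. r ` B y)"
  have openrB: "open (r ` B y)" if "y \<in> Y" for y
    by (rule invariance_of_domain[OF contB[OF that]]) (use e(3)[OF that] in \<open>auto simp: B_def\<close>)
  have openT: "open T"
    unfolding T_def using openV finY openrB by (intro open_Int open_INT) auto
  have xT: "x \<in> T"
    using x \<delta>(1) Y e(1) unfolding T_def B_def by (auto simp: image_iff) (metis centre_in_ball)
  define u where "u = (\<lambda>y. B y \<inter> r -` T)"
  have TV: "T \<subseteq> ?V" by (auto simp: T_def)
  have openu: "open (u y)" if "y \<in> Y" for y
    unfolding u_def by (rule continuous_open_preimage[OF contB[OF that] _ openT]) (simp add: B_def)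
  show "\<exists>T. x \<in> T \<and> openin (top_of_set ?V) T \<and>
           (\<exists>v. \<Union>v = ?C \<inter> r -` T \<and> (\<forall>u \<in> v. openin (top_of_set ?C) u) \<and>
           pairwise disjnt v \<and> (\<forall>u \<in> v. \<exists>q. homeomorphism u T r q))"
  proof (intro exI[of _ T] exI[of _ "u ` Y"] conjI ballI xT)
    show "openin (top_of_set ?V) T" using openT TV openV by (simp add: openin_open_eq)
    show "\<Union>(u ` Y) = ?C \<inter> r -` T"
    proof
      show "\<Union>(u ` Y) \<subseteq> ?C \<inter> r -` T" using TV BS by (auto simp: u_def)
      show "?C \<inter> r -` T \<subseteq> \<Union>(u ` Y)"
      proof
        fix z assume z: "z \<in> ?C \<inter> r -` T"
        then have "dist (r z) x < \<delta>" by (auto simp: T_def dist_commute)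
        then have "z \<in> (\<Union>y\<in>Y. B y)" using \<delta>(2) z by blast
        then show "z \<in> \<Union>(u ` Y)" using z by (auto simp: u_def)
      qed
    qed
    show "pairwise disjnt (u ` Y)"
    proof (rule pairwiseI)
      fix A A' assume "A \<in> u ` Y" "A' \<in> u ` Y" "A \<noteq> A'"
      then obtain y y' where "y \<in> Y" "y' \<in> Y" "y \<noteq> y'" "A = u y" "A' = u y'" by blast
      then show "disjnt A A'" using disjB[of y y'] by (auto simp: disjnt_def u_def)
    qed
  next
    fix w assume "w \<in> u ` Y"
    then obtain y where y: "y \<in> Y" "w = u y" by blast
    have "u y \<subseteq> ?C" using BS y TV by (auto simp: u_def)
    then show "openin (top_of_set ?C) w" using openu[OF y(1)] openC y by (simp add: openin_open_eq)
    have "inj_on r (u y)" using e(3)[OF y(1)] by (auto simp: u_def B_def intro: inj_on_subset)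
    moreover have "continuous_on (u y) r" using contB[OF y(1)] by (rule continuous_on_subset) (auto simp: u_def)
    moreover have "r ` u y = T"
    proof
      show "T \<subseteq> r ` u y"
      proof
        fix t assume t: "t \<in> T"
        then have "t \<in> r ` B y" using y(1) by (auto simp: T_def)
        then show "t \<in> r ` u y" using t by (auto simp: u_def)
      qed
    qed (auto simp: u_def)
    ultimately show "\<exists>q. homeomorphism w T r q"
      using invariance_of_domain_homeomorphism[of "u y" r] openu[OF y(1)] y by auto
  qed
qed

lemma holomorphic_lift:
  assumes H: "convex H" "w0 \<in> H" and k: "k holomorphic_on H" "k ` H \<subseteq> - crit_vals P S"
    and y: "poly S y \<noteq> 0" "r y = k w0"
  obtains h where "h holomorphic_on H" "h w0 = y" "\<And>w. w \<in> H \<Longrightarrow> poly S (h w) \<noteq> 0"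
    "\<And>w. w \<in> H \<Longrightarrow> r (h w) = k w"
proof -
  let ?C = "{z. poly S z \<noteq> 0 \<and> r z \<notin> crit_vals P S}" and ?V = "- crit_vals P S"
  have fim: "k \<in> H \<rightarrow> ?V" using k(2) by auto
  have yC: "y \<in> ?C" using y k(2) H(2) by auto
  obtain h where h: "continuous_on H h" "h \<in> H \<rightarrow> ?C" "h w0 = y" "\<And>w. w \<in> H \<Longrightarrow> r (h w) = k w"
    by (rule covering_space_lift_strong[OF covering_space_r yC H(2) convex_imp_simply_connected[OF H(1)]
        convex_imp_locally_path_connected[OF H(1)] holomorphic_on_imp_continuous_on[OF k(1)] fim
        y(2)[symmetric]]) blast
  have openV: "open ?V" using finite_crit_vals by (simp add: finite_imp_closed open_Compl)
  have "open ({z. poly S z \<noteq> 0} \<inter> r -` ?V)"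
    by (rule continuous_open_preimage[OF rat_continuous open_poly_nonzero openV]) simp
  then have openC: "open ?C" by (simp add: vimage_def Int_def)
  have "h holomorphic_on H"
    by (rule covering_space_lift_is_holomorphic[OF covering_space_r openC _ k(1) fim h(2,1,4)])
       (auto intro: holomorphic_on_subset[OF rat_holomorphic])
  then show ?thesis using that h by auto
qed

lemma lift_unique:
  assumes H: "connected H" "w0 \<in> H" "w \<in> H" and h1: "continuous_on H h1" and h2: "continuous_on H h2"
    and nz: "\<And>w. w \<in> H \<Longrightarrow> poly S (h1 w) \<noteq> 0 \<and> poly S (h2 w) \<noteq> 0"
    and eq: "\<And>w. w \<in> H \<Longrightarrow> r (h1 w) = r (h2 w)" and nc: "\<And>w. w \<in> H \<Longrightarrow> r (h1 w) \<notin> crit_vals P S"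
    and eq0: "h1 w0 = h2 w0"
  shows "h1 w = h2 w"
proof (rule covering_space_lift_unique[where f = "\<lambda>w. r (h1 w)" and T = H and ?g1.0 = h1 and ?g2.0 = h2 and a = w0, OF covering_space_r])
  show "continuous_on H (\<lambda>w. r (h1 w))"
    by (rule continuous_on_compose2[OF rat_continuous[of "{z. poly S z \<noteq> 0}"] h1]) (use nz in auto)
qed (use assms in auto)

end

section \<open>A critical value in every basin\<close>

lemma holomorphic_cnj_conj:
  assumes "h holomorphic_on H" "open H"
  shows "(\<lambda>z. cnj (h (cnj z))) holomorphic_on cnj ` H"
proof -
  have "cnj ` cnj ` H = H" by (simp add: image_image)
  moreover have "open (cnj ` H)"
    by (rule invariance_of_domain) (auto simp: inj_on_def assms intro!: continuous_intros)
  ultimately show ?thesis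
    using holomorphic_on_compose_cnj_cnj[of h "cnj ` H"] assms by (simp add: o_def)
qed

context rat_fix_inf
begin

definition g where "g z = cnj (r z)"

text \<open>At a pole \<open>r\<close> has the junk value 0, so orbits through a pole are excluded explicitly.\<close>

definition basin :: "complex \<Rightarrow> complex set" where
  "basin z0 = {z. \<exists>x. x 0 = z \<and> (\<forall>n::nat. poly S (x n) \<noteq> 0 \<and> x (Suc n) = g (x n)) \<and> x \<longlonglongrightarrow> z0}"

lemma basin_nz: "z \<in> basin z0 \<Longrightarrow> poly S z \<noteq> 0"
  by (auto simp: basin_def)

lemma basin_backward:
  assumes "poly S y \<noteq> 0" "g y \<in> basin z0"
  shows "y \<in> basin z0"
proof -
  obtain x where x: "x 0 = g y" "\<And>n. poly S (x n) \<noteq> 0" "\<And>n. x (Suc n) = g (x n)" "x \<longlonglongrightarrow> z0"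
    using assms(2) by (auto simp: basin_def)
  define x' where "x' = case_nat y x"
  have "x' \<longlonglongrightarrow> z0" using x(4) by (subst filterlim_sequentially_Suc[symmetric]) (simp add: x'_def)
  moreover have "poly S (x' n) \<noteq> 0 \<and> x' (Suc n) = g (x' n)" for n
    using x assms(1) by (cases n) (auto simp: x'_def)
  ultimately show ?thesis unfolding basin_def by (intro CollectI exI[of _ x']) (simp add: x'_def)
qed

lemma basin_disjoint: "z \<in> basin z0 \<Longrightarrow> z \<in> basin z1 \<Longrightarrow> z0 = z1"
proof -
  assume "z \<in> basin z0" "z \<in> basin z1"
  then obtain x y where x: "x 0 = z" "\<And>n. x (Suc n) = g (x n)" "x \<longlonglongrightarrow> z0"
    and y: "y 0 = z" "\<And>n. y (Suc n) = g (y n)" "y \<longlonglongrightarrow> z1"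
    by (auto simp: basin_def)
  have "x n = y n" for n by (induction n) (use x y in auto)
  then have "x = y" by auto
  then show "z0 = z1" using x y LIMSEQ_unique by blast
qed

lemma continuous_on_g: "(\<And>z. z \<in> X \<Longrightarrow> poly S z \<noteq> 0) \<Longrightarrow> continuous_on X g"
  unfolding g_def by (intro continuous_intros rat_continuous)

lemma second_iterate_lift:
  assumes nc: "\<And>v. v \<in> crit_vals P S \<Longrightarrow> cnj v \<notin> basin z0"
    and H: "open H" "convex H" "w0 \<in> H" and h: "h holomorphic_on H" "h ` H \<subseteq> basin z0"
    and y: "poly S y \<noteq> 0" "poly S (g y) \<noteq> 0" "g (g y) = h w0"
  obtains h' where "h' holomorphic_on H" "h' w0 = y" "h' ` H \<subseteq> basin z0"
    "\<And>w. w \<in> H \<Longrightarrow> poly S (h' w) \<noteq> 0 \<and> poly S (g (h' w)) \<noteq> 0 \<and> g (g (h' w)) = h w"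
proof -
  have nc': "cnj v \<notin> crit_vals P S" if "v \<in> basin z0" for v
    using nc[of "cnj v"] that by auto
  have convH: "convex (cnj ` H)"
    by (rule convex_linear_image[OF bounded_linear.linear[OF bounded_linear_cnj] H(2)])
  have openH: "open (cnj ` H)"
    by (rule invariance_of_domain) (auto simp: inj_on_def H intro!: continuous_intros)
  have 1: "(\<lambda>z. cnj (h (cnj z))) ` (cnj ` H) \<subseteq> - crit_vals P S"
    using h(2) nc' by auto
  obtain l where l: "l holomorphic_on cnj ` H" "l (cnj w0) = g y"
     "\<And>w. w \<in> cnj ` H \<Longrightarrow> poly S (l w) \<noteq> 0" "\<And>w. w \<in> cnj ` H \<Longrightarrow> r (l w) = cnj (h (cnj w))"
  proof (rule holomorphic_lift[OF convH _ holomorphic_cnj_conj[OF h(1) H(1)] 1, of "cnj w0" "g y"])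
    show "r (g y) = cnj (h (cnj (cnj w0)))" using arg_cong[OF y(3), of cnj] by (simp add: g_def)
  qed (use H y in auto)
  have gl: "g (l (cnj w)) = h w" if "w \<in> H" for w using l(4)[of "cnj w"] that by (auto simp: g_def)
  have lb: "l (cnj w) \<in> basin z0" if "w \<in> H" for w
    by (rule basin_backward) (use l(3) gl[OF that] h(2) that in auto)
  have "(\<lambda>z. cnj (l (cnj z))) holomorphic_on cnj ` cnj ` H"
    by (rule holomorphic_cnj_conj[OF l(1) openH])
  then have hol: "(\<lambda>z. cnj (l (cnj z))) holomorphic_on H" by (simp add: image_image)
  obtain h' where h': "h' holomorphic_on H" "h' w0 = y"
     "\<And>w. w \<in> H \<Longrightarrow> poly S (h' w) \<noteq> 0" "\<And>w. w \<in> H \<Longrightarrow> r (h' w) = cnj (l (cnj w))"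
    by (rule holomorphic_lift[OF H(2,3) hol, of y])
       (use lb nc' y l(2) in \<open>auto simp: g_def\<close>)
  have gh: "g (h' w) = l (cnj w)" if "w \<in> H" for w using h'(4)[OF that] by (simp add: g_def)
  show ?thesis
  proof
    show "h' ` H \<subseteq> basin z0"
      using basin_backward h'(3) gh lb by auto
  qed (use h' gh gl l(3) in auto)
qed

lemma second_iterate_lift_unique:
  assumes nc: "\<And>v. v \<in> crit_vals P S \<Longrightarrow> cnj v \<notin> basin z0"
    and H: "connected H" "w0 \<in> H" "w \<in> H" and h1: "continuous_on H h1" and h2: "continuous_on H h2"
    and b1: "h1 ` H \<subseteq> basin z0" and b2: "h2 ` H \<subseteq> basin z0"
    and nz: "\<And>w. w \<in> H \<Longrightarrow> poly S (g (h1 w)) \<noteq> 0 \<and> poly S (g (h2 w)) \<noteq> 0"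
    and eq: "\<And>w. w \<in> H \<Longrightarrow> g (g (h1 w)) = g (g (h2 w))"
    and b: "\<And>w. w \<in> H \<Longrightarrow> g (g (h1 w)) \<in> basin z0"
    and eq0: "h1 w0 = h2 w0"
  shows "h1 w = h2 w"
proof -
  have nc': "cnj v \<notin> crit_vals P S" if "v \<in> basin z0" for v
    using nc[of "cnj v"] that by auto
  have cg: "continuous_on H (\<lambda>w. g (h w))" if "continuous_on H h" "h ` H \<subseteq> basin z0" for h
    by (rule continuous_on_compose2[OF continuous_on_g[of "basin z0"] that]) (rule basin_nz)
  have 1: "g (h1 w) = g (h2 w)" if "w \<in> H" for w
  proof (rule lift_unique[OF H(1,2) that cg[OF h1 b1] cg[OF h2 b2] nz])
    show "r (g (h1 w)) = r (g (h2 w))" if "w \<in> H" for w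
      using eq[OF that] by (simp add: g_def)
    show "r (g (h1 w)) \<notin> crit_vals P S" if "w \<in> H" for w
      using nc'[OF b[OF that]] by (simp add: g_def)
  qed (simp_all add: eq0)
  show ?thesis
  proof (rule lift_unique[OF H h1 h2])
    show "poly S (h1 w) \<noteq> 0 \<and> poly S (h2 w) \<noteq> 0" if "w \<in> H" for w
      using b1 b2 that basin_nz by auto
    show "r (h1 w) = r (h2 w)" if "w \<in> H" for w
      using 1[OF that] by (simp add: g_def)
    show "r (h1 w) \<notin> crit_vals P S" if w: "w \<in> H" for w
      using nc'[OF basin_backward[of "g (h1 w)"]] nz[OF w] b[OF w] by (simp add: g_def)
  qed (rule eq0)
qed

text \<open>A pole lies in no basin. If there is none, \<open>r\<close> is a polynomial with a
  finite critical point, whose conjugated critical value is outside by \<open>nc\<close>. The point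
  found is the omitted value for the Lipschitz bound.\<close>

lemma basin_not_everything:
  assumes nc: "\<And>v. v \<in> crit_vals P S \<Longrightarrow> cnj v \<notin> basin z0" and d: "degree P \<ge> 2"
  obtains a where "a \<notin> basin z0"
proof (cases "degree S = 0")
  case True
  have "degree (wronskian P S) > 0" using wronskian_degree d by simp
  then obtain c where c: "poly (wronskian P S) c = 0" using poly_exists_root by blast
  obtain s where "S = [:s:]" "s \<noteq> 0" using True S_nz by (metis degree_eq_zeroE pCons_0_0)
  then have "r c \<in> crit_vals P S" using c by (auto simp: crit_vals_def)
  then show ?thesis using nc that by blast
next
  case False
  then obtain a where "poly S a = 0" using poly_exists_root by blast
  then show ?thesis using that basin_nz by blast
qed

text \<open>Without critical values in the basin there are univalent maps \<open>h\<close> with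
  \<open>h ((F ^^ n) w) = \<zeta> w\<close> on all of \<open>H\<close>. They send two consecutive
  orbit points to the fixed pair \<open>\<zeta> w0\<close>, \<open>\<zeta> (F w0)\<close>, whereas
  the Lipschitz bound on the disc of radius \<open>\<rho> n\<close> makes the distance of the images
  tend to 0. The map \<open>\<zeta>\<close> is the inclusion for an attracting disc and the inverse
  of a petal coordinate in the neutral case.\<close>

theorem basin_contains_critical_value:
  assumes d: "degree P \<ge> 2"
    and H: "open H" "convex H" and \<zeta>: "\<zeta> holomorphic_on H" "inj_on \<zeta> H" "\<zeta> ` H \<subseteq> basin z0"
    and F: "continuous_on H F" "F ` H \<subseteq> H"
    and conj: "\<And>w. w \<in> H \<Longrightarrow> poly S (g (\<zeta> w)) \<noteq> 0 \<and> g (g (\<zeta> w)) = \<zeta> (F w)"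
    and w0: "w0 \<in> H" "F w0 \<noteq> w0"
    and \<rho>: "\<And>n. \<rho> n > 0" "\<And>n. ball ((F ^^ n) w0) (\<rho> n) \<subseteq> H"
    and lim: "(\<lambda>n. dist ((F ^^ n) w0) ((F ^^ Suc n) w0) / \<rho> n) \<longlonglongrightarrow> 0"
  obtains v where "v \<in> crit_vals P S" "cnj v \<in> basin z0"
proof (rule ccontr)
  assume contr: "\<not> thesis"
  then have nc: "\<And>v. v \<in> crit_vals P S \<Longrightarrow> cnj v \<notin> basin z0" using that by blast
  have Fn: "(F ^^ n) w \<in> H" if "w \<in> H" for n w
    by (induction n) (use F(2) that in auto)
  have conn: "connected H" using H(2) by (rule convex_connected)
  have contF: "continuous_on H (F ^^ n)" for n
  proof (induction n)
    case (Suc n)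
    have "continuous_on H (\<lambda>w. F ((F ^^ n) w))"
      by (rule continuous_on_compose2[OF F(1) Suc]) (use Fn in auto)
    then show ?case by (simp add: o_def)
  qed (simp add: id_def)
  \<comment> \<open>Here \<open>h\<close> is \<open>\<zeta>\<close> followed by an inverse branch of
    the n-th iterate of \<open>g \<circ> g\<close>. The normalisation on the image of
    \<open>F ^^ n\<close> selects the branch that undoes the forward orbit.\<close>
  have ex: "\<exists>h. h holomorphic_on H \<and> h ` H \<subseteq> basin z0 \<and> inj_on h H \<and> (\<forall>w\<in>H. h ((F ^^ n) w) = \<zeta> w)" for n
  proof (induction n)
    case 0
    then show ?case using \<zeta> by (intro exI[of _ \<zeta>]) auto
  next
    case (Suc n)
    then obtain h where h: "h holomorphic_on H" "h ` H \<subseteq> basin z0" "inj_on h H"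
      "\<And>w. w \<in> H \<Longrightarrow> h ((F ^^ n) w) = \<zeta> w" by blast
    have FF: "(F ^^ Suc n) w = (F ^^ n) (F w)" for w by (simp add: funpow_swap1)
    have hF: "h ((F ^^ Suc n) w) = \<zeta> (F w)" if "w \<in> H" for w
      unfolding FF using h(4)[of "F w"] F(2) that by auto
    have \<zeta>nz: "poly S (\<zeta> w) \<noteq> 0" if "w \<in> H" for w using \<zeta>(3) that basin_nz by blast
    obtain h' where h': "h' holomorphic_on H" "h' ((F ^^ Suc n) w0) = \<zeta> w0" "h' ` H \<subseteq> basin z0"
      "\<And>w. w \<in> H \<Longrightarrow> poly S (h' w) \<noteq> 0 \<and> poly S (g (h' w)) \<noteq> 0 \<and> g (g (h' w)) = h w"
      by (rule second_iterate_lift[OF nc H Fn[OF w0(1)] h(1,2), of "\<zeta> w0" "Suc n"])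
         (use \<zeta>nz conj w0 hF in auto)
    \<comment> \<open>The value \<open>h' w\<close> determines \<open>h w = g (g (h' w))\<close>, so
      injectivity is inherited from \<open>h\<close>.\<close>
    have "inj_on h' H"
      by (rule inj_onI) (metis h'(4) h(3) inj_onD)
    moreover have "h' ((F ^^ Suc n) w) = \<zeta> w" if w: "w \<in> H" for w
    proof (rule second_iterate_lift_unique[OF nc conn w0(1) w, of "\<lambda>w. h' ((F ^^ Suc n) w)" \<zeta>])
      show "continuous_on H (\<lambda>w. h' ((F ^^ Suc n) w))"
        by (rule continuous_on_compose2[OF holomorphic_on_imp_continuous_on[OF h'(1)] contF])
           (use Fn in blast)
      show "continuous_on H \<zeta>" using \<zeta>(1) by (rule holomorphic_on_imp_continuous_on)
      show "(\<lambda>w. h' ((F ^^ Suc n) w)) ` H \<subseteq> basin z0" using h'(3) Fn by blast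
      show "poly S (g (h' ((F ^^ Suc n) w))) \<noteq> 0 \<and> poly S (g (\<zeta> w)) \<noteq> 0" if "w \<in> H" for w
        using h'(4)[OF Fn[OF that]] conj[OF that] by blast
      show "g (g (h' ((F ^^ Suc n) w))) = g (g (\<zeta> w))" if "w \<in> H" for w
        using h'(4)[OF Fn[OF that, of "Suc n"]] conj[OF that] hF[OF that] by simp
      show "g (g (h' ((F ^^ Suc n) w))) \<in> basin z0" if "w \<in> H" for w
        using h'(4)[OF Fn[OF that, of "Suc n"]] h(2) Fn[OF that, of "Suc n"] by auto
    qed (use \<zeta>(3) h'(2) in auto)
    ultimately show ?case using h'(1,3) by blast
  qed
  obtain a where a: "a \<notin> basin z0" using basin_not_everything[OF nc d] by blast
  obtain M where M: "M > 0"
    "\<And>f w \<rho> a t. \<lbrakk>f holomorphic_on ball w \<rho>; inj_on f (ball w \<rho>); a \<notin> f ` ball w \<rho>;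
        \<rho> > 0; dist w t < \<rho> / 4\<rbrakk> \<Longrightarrow> norm (f t - f w) \<le> M * norm (f w - a) * (dist w t / \<rho>)"
    by (rule univalent_omitting_Lipschitz) blast
  define D where "D = norm (\<zeta> (F w0) - \<zeta> w0)"
  have Dpos: "D > 0"
    using inj_onD[OF \<zeta>(2), of "F w0" w0] w0 F(2) by (auto simp: D_def)
  have ev: "\<forall>\<^sub>F n in sequentially. dist ((F ^^ n) w0) ((F ^^ Suc n) w0) / \<rho> n < 1/4"
    using order_tendstoD(2)[OF lim, of "1/4"] by simp
  have "\<forall>\<^sub>F n in sequentially. D \<le> M * norm (\<zeta> w0 - a) * (dist ((F ^^ n) w0) ((F ^^ Suc n) w0) / \<rho> n)"
    using ev
  proof eventually_elim
    case (elim n)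
    obtain h where h: "h holomorphic_on H" "h ` H \<subseteq> basin z0" "inj_on h H"
      "\<And>w. w \<in> H \<Longrightarrow> h ((F ^^ n) w) = \<zeta> w" using ex[of n] by blast
    have "norm (h ((F ^^ Suc n) w0) - h ((F ^^ n) w0)) \<le>
       M * norm (h ((F ^^ n) w0) - a) * (dist ((F ^^ n) w0) ((F ^^ Suc n) w0) / \<rho> n)"
    proof (rule M(2)[OF holomorphic_on_subset[OF h(1) \<rho>(2)] inj_on_subset[OF h(3) \<rho>(2)] _ \<rho>(1)])
      show "a \<notin> h ` ball ((F ^^ n) w0) (\<rho> n)" using h(2) a \<rho>(2) by blast
      show "dist ((F ^^ n) w0) ((F ^^ Suc n) w0) < \<rho> n / 4"
        using elim \<rho>(1)[of n] by (simp add: field_simps)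
    qed
    moreover have "h ((F ^^ Suc n) w0) = \<zeta> (F w0)"
      using h(4)[of "F w0"] F(2) w0(1) by (auto simp: funpow_swap1)
    ultimately show ?case using h(4)[OF w0(1)] by (simp add: D_def)
  qed
  moreover have "(\<lambda>n. M * norm (\<zeta> w0 - a) * (dist ((F ^^ n) w0) ((F ^^ Suc n) w0) / \<rho> n)) \<longlonglongrightarrow> M * norm (\<zeta> w0 - a) * 0"
    by (intro tendsto_intros lim)
  ultimately have "D \<le> 0"
    by (intro tendsto_le[OF trivial_limit_sequentially _ tendsto_const]) auto
  then show False using Dpos by simp
qed

end

section \<open>The second iterate, and attracting fixed points\<close>

lemma tendsto_even_odd:
  assumes "(\<lambda>n. x (2 * n)) \<longlonglongrightarrow> l" "(\<lambda>n. x (Suc (2 * n))) \<longlonglongrightarrow> (l :: 'a :: metric_space)"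
  shows "x \<longlonglongrightarrow> l"
proof (rule metric_LIMSEQ_I)
  fix e :: real assume e: "e > 0"
  obtain N1 where N1: "\<And>n. n \<ge> N1 \<Longrightarrow> dist (x (2 * n)) l < e"
    using metric_LIMSEQ_D[OF assms(1) e] by blast
  obtain N2 where N2: "\<And>n. n \<ge> N2 \<Longrightarrow> dist (x (Suc (2 * n))) l < e"
    using metric_LIMSEQ_D[OF assms(2) e] by blast
  have "dist (x n) l < e" if "n \<ge> 2 * (N1 + N2)" for n
  proof (cases "even n")
    case True
    then show ?thesis using N1[of "n div 2"] that by auto
  next
    case False
    then obtain k where "n = Suc (2 * k)" by (metis oddE add.commute plus_1_eq_Suc)
    then show ?thesis using N2[of k] that by auto
  qed
  then show "\<exists>no. \<forall>n\<ge>no. dist (x n) l < e" by blast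
qed

context rat_fix_inf
begin

text \<open>Over a value outside \<open>crit_vals\<close> the fibre polynomial has simple roots
  only, so degree at least 2 yields two different ones.\<close>

lemma two_preimages:
  assumes "degree P \<ge> 2"
  obtains y y' where "y \<noteq> y'" "poly S y \<noteq> 0" "poly S y' \<noteq> 0" "r y = r y'"
proof -
  obtain x where x: "x \<notin> crit_vals P S"
    using finite_crit_vals infinite_UNIV_char_0 by (metis ex_new_if_finite)
  define T where "T = P - smult x S"
  have dT: "degree T \<ge> 2" using degree_fibre_poly assms by (simp add: T_def)
  then obtain y where y: "poly T y = 0" using poly_exists_root[of T] by auto
  then obtain T' where T': "T = [:-y, 1:] * T'" by (metis dvdE poly_eq_0_iff_dvd)
  then have "T' \<noteq> 0" using dT by auto
  then have "degree T = 1 + degree T'" unfolding T' by (subst degree_mult_eq) auto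
  then obtain y' where y': "poly T' y' = 0" using poly_exists_root[of T'] dT by auto
  have yT': "poly T y' = 0" using y' unfolding T' by simp
  have Sy: "poly S y \<noteq> 0" "r y = x" using fibre_iff[of y x] y by (auto simp: T_def)
  have Sy': "poly S y' \<noteq> 0" "r y' = x" using fibre_iff[of y' x] yT' by (auto simp: T_def)
  have "y \<noteq> y'"
  proof
    assume "y = y'"
    then have "poly (pderiv T) y = 0" using y' unfolding T' pderiv_mult by (simp del: mult_pCons_left)
    then have 1: "poly (pderiv P) y = x * poly (pderiv S) y" by (simp add: T_def pderiv_diff pderiv_smult)
    have 2: "poly P y = x * poly S y" using y by (simp add: T_def)
    have "poly (wronskian P S) y = 0" unfolding wronskian_def by (simp add: 1 2)
    then show False using x Sy by (auto simp: crit_vals_def)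
  qed
  then show ?thesis using that Sy Sy' by simp
qed

lemma g_g_holomorphic: "(\<lambda>z. g (g z)) holomorphic_on {z. poly S z \<noteq> 0 \<and> poly S (g z) \<noteq> 0}"
proof -
  have "(\<lambda>z. cnj (r (cnj z))) holomorphic_on cnj ` {z. poly S z \<noteq> 0}"
    by (rule holomorphic_cnj_conj[OF rat_holomorphic open_poly_nonzero])
  then have "(\<lambda>z. cnj (r (cnj (r z)))) holomorphic_on {z. poly S z \<noteq> 0 \<and> poly S (g z) \<noteq> 0}"
  proof (rule holomorphic_on_compose_gen[unfolded o_def, rotated])
    show "r ` {z. poly S z \<noteq> 0 \<and> poly S (g z) \<noteq> 0} \<subseteq> cnj ` {z. poly S z \<noteq> 0}"
    proof clarify
      fix z assume "poly S (g z) \<noteq> 0"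
      then show "r z \<in> cnj ` {z. poly S z \<noteq> 0}"
        by (intro image_eqI[of _ _ "g z"]) (simp_all add: g_def)
    qed
  qed (rule holomorphic_on_subset[OF rat_holomorphic], auto)
  then show ?thesis by (simp add: g_def)
qed

lemma open_g_domain: "open {z. poly S z \<noteq> 0 \<and> poly S (g z) \<noteq> 0}"
proof -
  have "open ({z. poly S z \<noteq> 0} \<inter> g -` {z. poly S z \<noteq> 0})"
    by (rule continuous_open_preimage[OF continuous_on_g open_poly_nonzero open_poly_nonzero]) simp
  then show ?thesis by (simp add: vimage_def Int_def)
qed

text \<open>Conjugation pairs \<open>deriv r z0\<close> with its own conjugate. So the multiplier is
  real and non-negative, and a neutral fixed point is always parabolic with multiplier 1.\<close>

lemma g_g_derivative:
  assumes z0: "poly S z0 \<noteq> 0" "g z0 = z0"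
  shows "((\<lambda>z. g (g z)) has_field_derivative of_real ((norm (deriv r z0))\<^sup>2)) (at z0)"
proof -
  have 1: "(r has_field_derivative deriv r z0) (at z0)"
    using rat_has_field_derivative[OF z0(1)] deriv_rat[OF z0(1)] by metis
  have rz: "r z0 = cnj z0" using arg_cong[OF z0(2), of cnj] by (simp add: g_def)
  have "((cnj \<circ> r \<circ> cnj) has_field_derivative cnj (deriv r z0)) (at (cnj z0))"
    using 1 has_field_derivative_cnj_cnj[of r "deriv r z0" "cnj z0"] by simp
  then have "((\<lambda>z. (cnj \<circ> r \<circ> cnj) (r z)) has_field_derivative cnj (deriv r z0) * deriv r z0) (at z0)"
    unfolding rz[symmetric] by (rule DERIV_chain2[OF _ 1])
  moreover have "cnj (deriv r z0) * deriv r z0 = of_real ((norm (deriv r z0))\<^sup>2)"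
    by (simp add: complex_norm_square mult.commute flip: of_real_power)
  ultimately show ?thesis by (simp add: g_def[abs_def])
qed

text \<open>By analytic continuation \<open>g \<circ> g\<close> would be the identity everywhere,
  which is incompatible with two points having the same image under \<open>r\<close>. At a neutral
  point this gives \<open>g (g z) - z\<close> a zero of finite order.\<close>

lemma g_g_not_identity:
  assumes d: "degree P \<ge> 2" and U: "open U" "U \<noteq> {}" "U \<subseteq> {z. poly S z \<noteq> 0 \<and> poly S (g z) \<noteq> 0}"
  obtains z where "z \<in> U" "g (g z) \<noteq> z"
proof (rule ccontr)
  assume "\<not> thesis"
  then have id: "\<And>z. z \<in> U \<Longrightarrow> g (g z) = z" using that by blast
  let ?D = "UNIV - {z. poly S z = 0}"
  have conn: "connected ?D"
    by (rule connected_open_delete_finite) (use S_nz in \<open>auto intro: poly_roots_finite\<close>)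
  have opD: "open ?D" using open_poly_nonzero[of S] by (simp add: Compl_eq_Diff_UNIV[symmetric] Collect_neg_eq)
  have holr: "r holomorphic_on ?D" by (rule holomorphic_on_subset[OF rat_holomorphic]) auto
  have pol: "(\<lambda>u. cnj (poly T (cnj u))) holomorphic_on UNIV" for T :: "complex poly"
  proof -
    have "poly T holomorphic_on UNIV" by (intro holomorphic_intros)
    then have "(\<lambda>u. cnj (poly T (cnj u))) holomorphic_on cnj ` UNIV"
      by (rule holomorphic_cnj_conj) simp
    moreover have "cnj ` UNIV = UNIV" by (metis complex_cnj_cnj surjI)
    ultimately show ?thesis by simp
  qed
  have pol': "(\<lambda>u. cnj (poly T (cnj (r u)))) holomorphic_on ?D" for T :: "complex poly"
    by (rule holomorphic_on_compose_gen[OF holr pol, unfolded o_def]) simp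
  \<comment> \<open>This is the equation \<open>g (g z) = z\<close> with the outer denominator
    cleared, so it remains holomorphic where \<open>g z\<close> is a pole.\<close>
  define \<phi> where "\<phi> = (\<lambda>z. cnj (poly P (cnj (r z))) - z * cnj (poly S (cnj (r z))))"
  have hol\<phi>: "\<phi> holomorphic_on ?D"
    unfolding \<phi>_def by (intro holomorphic_intros pol')
  have "\<phi> z = 0" if "z \<in> U" for z
  proof -
    have "poly S (g z) \<noteq> 0" using U(3) that by auto
    then have "poly P (g z) = cnj (g (g z)) * poly S (g z)" by (simp add: g_def rat_def)
    then show ?thesis using id[OF that] by (simp add: \<phi>_def g_def)
  qed
  then have \<phi>0: "\<phi> z = 0" if "z \<in> ?D" for z
    using analytic_continuation_open[OF U(1) opD U(2) conn _ hol\<phi> holomorphic_on_const[of 0]] U(3) that by auto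
  obtain y y' where y: "y \<noteq> y'" "poly S y \<noteq> 0" "poly S y' \<noteq> 0" "r y = r y'"
    by (rule two_preimages[OF d])
  have 1: "cnj (poly P (g y)) = y * cnj (poly S (g y))" using \<phi>0[of y] y by (simp add: \<phi>_def g_def)
  have 2: "cnj (poly P (g y)) = y' * cnj (poly S (g y))" using \<phi>0[of y'] y by (simp add: \<phi>_def g_def)
  have "poly S (g y) = 0" using 1 2 y(1) by auto
  moreover from this have "poly P (g y) = 0" using 1 by simp
  ultimately show False using coprime_poly_common_root[OF cop] by blast
qed

text \<open>The orbit of \<open>F\<close> controls the even iterates of \<open>g\<close> only; the
  odd ones converge because \<open>g\<close> is continuous at its fixed point
  \<open>z0\<close>.\<close>

lemma basin_via_semiconjugacy:
  assumes z0: "poly S z0 \<noteq> 0" "g z0 = z0"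
    and conj: "\<And>w. w \<in> H \<Longrightarrow> poly S (\<zeta> w) \<noteq> 0 \<and> poly S (g (\<zeta> w)) \<noteq> 0 \<and> g (g (\<zeta> w)) = \<zeta> (F w)"
    and F: "F ` H \<subseteq> H" and w: "w \<in> H" and lim: "(\<lambda>n. \<zeta> ((F ^^ n) w)) \<longlonglongrightarrow> z0"
  shows "\<zeta> w \<in> basin z0"
proof -
  have Fn: "(F ^^ n) w \<in> H" for n by (induction n) (use F w in auto)
  define x where "x = (\<lambda>n. (g ^^ n) (\<zeta> w))"
  have ev: "x (2 * n) = \<zeta> ((F ^^ n) w)" for n
  proof (induction n)
    case (Suc n)
    have "x (2 * Suc n) = g (g (x (2 * n)))" by (simp add: x_def)
    then show ?case using Suc conj[OF Fn] by simp
  qed (simp add: x_def)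
  have od: "x (Suc (2 * n)) = g (\<zeta> ((F ^^ n) w))" for n
    using ev[of n] by (simp add: x_def)
  have cont: "continuous_on {z. poly S z \<noteq> 0} g" by (rule continuous_on_g) simp
  have "(\<lambda>n. g (\<zeta> ((F ^^ n) w))) \<longlonglongrightarrow> g z0"
    by (rule continuous_on_tendsto_compose[OF cont lim]) (use z0 conj Fn in auto)
  then have "(\<lambda>n. x (Suc (2 * n))) \<longlonglongrightarrow> z0" using z0 by (simp add: od)
  moreover have "(\<lambda>n. x (2 * n)) \<longlonglongrightarrow> z0" using lim by (simp add: ev)
  ultimately have "x \<longlonglongrightarrow> z0" by (rule tendsto_even_odd[rotated])
  moreover have "poly S (x n) \<noteq> 0" for n
  proof (cases "even n")
    case True
    then show ?thesis using ev[of "n div 2"] conj[OF Fn] by auto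
  next
    case False
    then obtain k where "n = Suc (2 * k)" by (metis oddE add.commute plus_1_eq_Suc)
    then show ?thesis using od[of k] conj[OF Fn] by auto
  qed
  ultimately show ?thesis
    unfolding basin_def by (intro CollectI exI[of _ x]) (simp add: x_def)
qed

lemma attracting_basin_critical_value:
  assumes d: "degree P \<ge> 2" and z0: "poly S z0 \<noteq> 0" "g z0 = z0" and less: "norm (deriv r z0) < 1"
  obtains v where "v \<in> crit_vals P S" "cnj v \<in> basin z0"
proof -
  let ?U = "{z. poly S z \<noteq> 0 \<and> poly S (g z) \<noteq> 0}"
  define F where "F = (\<lambda>z. g (g z))"
  define \<mu> where "\<mu> = (norm (deriv r z0))\<^sup>2"
  have \<mu>: "\<mu> < 1" "\<mu> \<ge> 0" using less by (auto simp: \<mu>_def power_less_one_iff abs_square_less_1)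
  \<comment> \<open>Any number strictly between \<open>\<mu>\<close> and 1 is a contraction factor
    near \<open>z0\<close>; the superattracting case \<open>\<mu> = 0\<close> is included.\<close>
  define c where "c = (\<mu> + 1) / 2"
  have c: "\<mu> < c" "c < 1" "0 \<le> c" using \<mu> by (auto simp: c_def)
  have F0: "F z0 = z0" using z0 by (simp add: F_def)
  have "(F has_field_derivative of_real \<mu>) (at z0)"
    using g_g_derivative[OF z0] by (simp add: F_def \<mu>_def)
  then have "((\<lambda>z. (F z - z0) / (z - z0)) \<longlongrightarrow> of_real \<mu>) (at z0)"
    by (simp add: has_field_derivative_iff F0)
  then have "((\<lambda>z. norm ((F z - z0) / (z - z0))) \<longlongrightarrow> \<mu>) (at z0)"
    using tendsto_norm[of _ "of_real \<mu> :: complex"] \<mu> by force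
  then have ev: "\<forall>\<^sub>F z in at z0. norm ((F z - z0) / (z - z0)) < c"
    using c(1) by (rule order_tendstoD(2))
  have z0U: "z0 \<in> ?U" using z0 by simp
  obtain e1 where e1: "e1 > 0" "ball z0 e1 \<subseteq> ?U" by (rule openE[OF open_g_domain z0U])
  obtain e2 where e2: "e2 > 0" "\<And>z. z \<noteq> z0 \<Longrightarrow> dist z z0 < e2 \<Longrightarrow> norm ((F z - z0) / (z - z0)) < c"
    using ev unfolding eventually_at by blast
  define e where "e = min e1 e2"
  have e: "e > 0" "ball z0 e \<subseteq> ?U" using e1 e2(1) by (auto simp: e_def)
  have contr: "dist (F z) z0 \<le> c * dist z z0" if "z \<in> ball z0 e" for z
  proof (cases "z = z0")
    case False
    have "norm ((F z - z0) / (z - z0)) < c" using e2(2)[OF False] that by (simp add: e_def dist_commute)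
    then show ?thesis using False by (simp add: norm_divide dist_norm field_simps)
  qed (simp add: F0)
  have FH: "F ` ball z0 e \<subseteq> ball z0 e"
  proof
    fix w assume "w \<in> F ` ball z0 e"
    then obtain z where z: "z \<in> ball z0 e" "w = F z" by blast
    have "c * dist z z0 \<le> 1 * dist z z0" using c by (intro mult_right_mono) auto
    then show "w \<in> ball z0 e" using contr[OF z(1)] z by (simp add: dist_commute)
  qed
  have Fn: "(F ^^ n) w \<in> ball z0 e \<and> dist ((F ^^ n) w) z0 \<le> c ^ n * dist w z0" if w: "w \<in> ball z0 e" for n w
  proof (induction n)
    case (Suc n)
    have "dist ((F ^^ Suc n) w) z0 \<le> c * dist ((F ^^ n) w) z0" using contr Suc by simp
    also have "\<dots> \<le> c * (c ^ n * dist w z0)" using Suc c by (intro mult_left_mono) auto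
    finally show ?case using Suc FH by (simp add: image_subset_iff mult.assoc)
  qed (use w in auto)
  have lim: "(\<lambda>n. (F ^^ n) w) \<longlonglongrightarrow> z0" if w: "w \<in> ball z0 e" for w
  proof (rule metric_tendsto_imp_tendsto)
    show "(\<lambda>n. c ^ n * dist w z0) \<longlonglongrightarrow> 0"
      using c by (intro tendsto_mult_left_zero LIMSEQ_power_zero) auto
    show "\<forall>\<^sub>F n in sequentially. dist ((F ^^ n) w) z0 \<le> dist (c ^ n * dist w z0) 0"
      using Fn[OF w] c by (auto intro!: always_eventually simp: dist_real_def abs_mult)
  qed
  \<comment> \<open>The orbit starts at distance \<open>e/2\<close> from \<open>z0\<close> and never
    moves farther away, so discs of the constant radius \<open>e/2\<close> about its points stay
    inside. The required ratio tends to 0 because the orbit converges.\<close>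
  define w0 where "w0 = z0 + of_real (e/2)"
  have w0: "w0 \<in> ball z0 e" "dist w0 z0 = e / 2" using e(1) by (auto simp: w0_def dist_norm)
  show ?thesis
  proof (rule basin_contains_critical_value[OF d open_ball convex_ball, of "\<lambda>z. z" z0 e z0 F w0 "\<lambda>_. e/2"])
    show "(\<lambda>z. z) ` ball z0 e \<subseteq> basin z0"
    proof clarify
      fix w assume w: "w \<in> ball z0 e"
      show "w \<in> basin z0"
        by (rule basin_via_semiconjugacy[OF z0, of "ball z0 e" "\<lambda>z. z" F])
           (use e FH w lim[OF w] in \<open>auto simp: F_def\<close>)
    qed
    show "continuous_on (ball z0 e) F"
      unfolding F_def using holomorphic_on_imp_continuous_on[OF g_g_holomorphic] e(2)
      by (rule continuous_on_subset)
    show "F w0 \<noteq> w0"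
    proof
      assume "F w0 = w0"
      then have "e / 2 \<le> c * (e / 2)" using contr[OF w0(1)] w0(2) by simp
      then show False using c(2) e(1) by (simp add: field_simps)
    qed
    show "ball ((F ^^ n) w0) (e/2) \<subseteq> ball z0 e" for n
    proof
      fix z assume "z \<in> ball ((F ^^ n) w0) (e/2)"
      then have 1: "dist ((F ^^ n) w0) z < e/2" by simp
      have "c ^ n * dist w0 z0 \<le> 1 * dist w0 z0" using c by (intro mult_right_mono power_le_one) auto
      then have "dist ((F ^^ n) w0) z0 \<le> e/2" using Fn[OF w0(1), of n] w0(2) by linarith
      then show "z \<in> ball z0 e" using 1 dist_triangle[of z0 z "(F ^^ n) w0"] by (simp add: dist_commute)
    qed
    have "(\<lambda>n. dist ((F ^^ n) w0) ((F ^^ Suc n) w0) / (e/2)) \<longlonglongrightarrow> dist z0 z0 / (e/2)"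
      using e(1) by (intro tendsto_intros lim[OF w0(1)] LIMSEQ_Suc) auto
    then show "(\<lambda>n. dist ((F ^^ n) w0) ((F ^^ Suc n) w0) / (e/2)) \<longlonglongrightarrow> 0" by simp
  qed (use e FH w0 that in \<open>auto simp: F_def\<close>)
qed

end

section \<open>Neutral fixed points and their petals\<close>

text \<open>The derivative of \<open>(1 + x) powr (- m)\<close> at 0; it produces the translation by
  1 in the petal coordinate.\<close>

lemma exp_minus_mult_Ln_lim:
  "((\<lambda>x. (exp (- of_nat m * Ln (1 + x)) - 1) / x) \<longlongrightarrow> - of_nat m) (at (0::complex))"
proof -
  have "((\<lambda>x. exp (- of_nat m * Ln (1 + x))) has_field_derivative - of_nat m) (at (0::complex))"
    by (auto intro!: derivative_eq_intros)
  then show ?thesis by (simp add: has_field_derivative_iff)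
qed

context rat_fix_inf
begin

text \<open>If \<open>g (g z) = z + (z - z0) ^ (m + 1) * h z\<close>, then the coordinate \<open>w = c / (z - z0) ^ m\<close> with
  \<open>c = - 1 / (m * h z0)\<close> conjugates \<open>g \<circ> g\<close> on an attracting petal to a map \<open>F\<close> of a right
  half plane with \<open>F w = w + 1 + o(1)\<close>.\<close>

lemma parabolic_basin_critical_value:
  assumes d: "degree P \<ge> 2" and z0: "poly S z0 \<noteq> 0" "g z0 = z0" and neutral: "norm (deriv r z0) = 1"
  obtains v where "v \<in> crit_vals P S" "cnj v \<in> basin z0"
proof -
  let ?U = "{z. poly S z \<noteq> 0 \<and> poly S (g z) \<noteq> 0}"
  have z0U: "z0 \<in> ?U" using z0 by simp
  obtain e1 where e1: "e1 > 0" "ball z0 e1 \<subseteq> ?U" by (rule openE[OF open_g_domain z0U])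
  define f where "f = (\<lambda>z. g (g z) - z)"
  have holf: "f holomorphic_on ball z0 e1"
    unfolding f_def by (intro holomorphic_intros holomorphic_on_subset[OF g_g_holomorphic e1(2)])
  have f0: "f z0 = 0" using z0 by (simp add: f_def)
  have nonconst: "\<not> f constant_on ball z0 e1"
  proof
    assume "f constant_on ball z0 e1"
    then have "\<And>z. z \<in> ball z0 e1 \<Longrightarrow> f z = 0"
      using f0 e1(1) by (metis centre_in_ball constant_on_def)
    moreover obtain z where "z \<in> ball z0 e1" "g (g z) \<noteq> z"
      by (rule g_g_not_identity[OF d open_ball _ e1(2)]) (use e1(1) in auto)
    ultimately show False by (auto simp: f_def)
  qed
  obtain h e n where n: "0 < n" and e: "0 < e" "ball z0 e \<subseteq> ball z0 e1"
    and h: "h holomorphic_on ball z0 e" "\<And>w. w \<in> ball z0 e \<Longrightarrow> f w = (w - z0) ^ n * h w"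
      "\<And>w. w \<in> ball z0 e \<Longrightarrow> h w \<noteq> 0"
    by (rule holomorphic_factor_zero_nonconstant[OF holf open_ball connected_ball _ f0 nonconst])
       (use e1(1) in auto)
  have conth: "continuous_on (ball z0 e) h" by (rule holomorphic_on_imp_continuous_on[OF h(1)])
  have h_tendsto: "(h \<longlongrightarrow> h z0) (nhds z0)"
    using conth e(1) by (simp add: continuous_on_eq_continuous_at isCont_def tendsto_at_iff_tendsto_nhds)
  \<comment> \<open>A simple zero of \<open>g (g z) - z\<close> would give a multiplier of
    \<open>g \<circ> g\<close> different from 1.\<close>
  have "n \<noteq> 1"
  proof
    assume n1: "n = 1"
    have "(f has_field_derivative of_real ((norm (deriv r z0))\<^sup>2) - 1) (at z0)"
      unfolding f_def by (intro derivative_intros g_g_derivative z0)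
    then have "((\<lambda>z. f z / (z - z0)) \<longlongrightarrow> 0) (at z0)"
      by (simp add: has_field_derivative_iff f0 neutral)
    moreover have "\<forall>\<^sub>F z in at z0. f z / (z - z0) = h z"
      unfolding eventually_at using e(1) h(2) n1 by (intro exI[of _ e]) (auto simp: dist_commute)
    ultimately have "(h \<longlongrightarrow> 0) (at z0)" by (rule Lim_transform_eventually)
    moreover have "(h \<longlongrightarrow> h z0) (at z0)" using h_tendsto by (simp add: tendsto_at_iff_tendsto_nhds)
    ultimately have "h z0 = 0" using tendsto_unique by (metis at_neq_bot)
    then show False using h(3) e(1) by auto
  qed
  define m where "m = n - 1"
  have m: "m > 0" "n = Suc m" using n \<open>n \<noteq> 1\<close> by (auto simp: m_def)
  have hz0: "h z0 \<noteq> 0" using h(3) e(1) by auto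
  define c where "c = - 1 / (of_nat m * h z0)"
  have c: "c \<noteq> 0" "c * h z0 * - of_nat m = 1" using hz0 m by (auto simp: c_def field_simps)
  define \<gamma> where "\<gamma> = exp (Ln c / of_nat m)"
  have \<gamma>: "\<gamma> \<noteq> 0" "\<gamma> ^ m = c" using m c by (simp_all add: \<gamma>_def exp_of_nat_mult[symmetric])
  \<comment> \<open>A branch of the m-th root of \<open>c / w\<close>, that is, the inverse of the
    petal coordinate up to the shift by \<open>z0\<close>.\<close>
  define \<eta> where "\<eta> = (\<lambda>w. \<gamma> * exp (- Ln w / of_nat m))"
  have \<eta>pow: "\<eta> w ^ m = c / w" if "w \<noteq> 0" for w
  proof -
    have "exp (- Ln w / of_nat m) ^ m = exp (- Ln w)" using m by (simp add: exp_of_nat_mult[symmetric])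
    then show ?thesis using \<gamma>(2) that by (simp add: \<eta>_def power_mult_distrib exp_minus field_simps)
  qed
  have \<eta>lim: "(\<eta> \<longlongrightarrow> 0) at_infinity"
  proof (rule tendsto_norm_zero_cancel)
    have "filterlim (\<lambda>w::complex. ln (norm w)) at_top at_infinity"
      by (rule filterlim_compose[OF ln_at_top filterlim_norm_at_top])
    then have "filterlim (\<lambda>w::complex. ln (norm w) * (1 / real m)) at_top at_infinity"
      using m by (intro filterlim_at_top_mult_tendsto_pos[OF tendsto_const]) auto
    then have "((\<lambda>w::complex. exp (- (ln (norm w) * (1 / real m)))) \<longlongrightarrow> 0) at_infinity"
      by (intro filterlim_compose[OF exp_at_bot] filterlim_compose[OF filterlim_uminus_at_bot_at_top])
    then have "((\<lambda>w::complex. norm \<gamma> * exp (- (ln (norm w) * (1 / real m)))) \<longlongrightarrow> 0) at_infinity"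
      by (rule tendsto_mult_right_zero)
    moreover have "\<forall>\<^sub>F w::complex in at_infinity. norm \<gamma> * exp (- (ln (norm w) * (1 / real m))) = norm (\<eta> w)"
    proof (rule eventually_at_infinityI[of 1])
      fix w :: complex assume "norm w \<ge> 1"
      then have "w \<noteq> 0" by auto
      then show "norm \<gamma> * exp (- (ln (norm w) * (1 / real m))) = norm (\<eta> w)"
        by (simp add: \<eta>_def norm_mult)
    qed
    ultimately show "((\<lambda>w. norm (\<eta> w)) \<longlongrightarrow> 0) at_infinity" by (rule Lim_transform_eventually)
  qed
  \<comment> \<open>For \<open>z = z0 + \<eta> w\<close> the quantity
    \<open>(z - z0) ^ m * h z\<close> is \<open>x w\<close>, so
    \<open>g (g z) - z0 = \<eta> w * (1 + x w)\<close>. In the coordinate \<open>w\<close> this is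
    multiplication by the power - m of \<open>1 + x w\<close>, which is how \<open>F\<close>
    arises.\<close>
  define x where "x = (\<lambda>w. c / w * h (z0 + \<eta> w))"
  define F where "F = (\<lambda>w. exp (Ln w - of_nat m * Ln (1 + x w)))"
  have "((\<lambda>w. z0 + \<eta> w) \<longlongrightarrow> z0 + 0) at_infinity" by (intro tendsto_intros \<eta>lim)
  then have hlim: "((\<lambda>w. h (z0 + \<eta> w)) \<longlongrightarrow> h z0) at_infinity"
    by (intro filterlim_compose[OF h_tendsto]) simp
  have xlim: "(x \<longlongrightarrow> 0) at_infinity"
  proof -
    have "((\<lambda>w. c / w) \<longlongrightarrow> 0) at_infinity"
      by (intro tendsto_divide_0[OF tendsto_const] filterlim_ident)
    then have "(x \<longlongrightarrow> 0 * h z0) at_infinity" unfolding x_def by (intro tendsto_intros hlim)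
    then show ?thesis by simp
  qed
  have ev\<eta>: "\<forall>\<^sub>F w in at_infinity. norm (\<eta> w) < e"
    using order_tendstoD(2)[OF tendsto_norm[OF \<eta>lim], of e] e(1) by simp
  have evx: "\<forall>\<^sub>F w in at_infinity. norm (x w) < 1/2"
    using order_tendstoD(2)[OF tendsto_norm[OF xlim], of "1/2"] by simp
  have evnz: "\<forall>\<^sub>F w in at_infinity. w \<noteq> (0::complex)"
    by (rule eventually_at_infinityI[of 1]) auto
  have evxnz: "\<forall>\<^sub>F w in at_infinity. x w \<noteq> 0"
    using ev\<eta> evnz
  proof eventually_elim
    case (elim w)
    then have "z0 + \<eta> w \<in> ball z0 e" by (simp add: dist_norm)
    then show ?case using h(3) c elim by (simp add: x_def)
  qed
  have xlim': "filterlim x (at 0) at_infinity" using xlim evxnz by (simp add: filterlim_at)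
  have "((\<lambda>w. c * h (z0 + \<eta> w) * ((exp (- of_nat m * Ln (1 + x w)) - 1) / x w))
      \<longlongrightarrow> c * h z0 * - of_nat m) at_infinity"
    by (intro tendsto_mult tendsto_const hlim filterlim_compose[OF exp_minus_mult_Ln_lim xlim'])
  moreover have "\<forall>\<^sub>F w in at_infinity. c * h (z0 + \<eta> w) * ((exp (- of_nat m * Ln (1 + x w)) - 1) / x w) = F w - w"
    using evxnz evnz
  proof eventually_elim
    case (elim w)
    have "c * h (z0 + \<eta> w) = w * x w" using elim by (simp add: x_def)
    then have "c * h (z0 + \<eta> w) * ((exp (- of_nat m * Ln (1 + x w)) - 1) / x w)
        = w * exp (- of_nat m * Ln (1 + x w)) - w" using elim by (simp add: field_simps)
    also have "w * exp (- of_nat m * Ln (1 + x w)) = F w"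
      using elim by (simp add: F_def exp_diff exp_minus field_simps)
    finally show ?case .
  qed
  ultimately have "((\<lambda>w. F w - w) \<longlongrightarrow> 1) at_infinity"
    unfolding c(2) by (rule Lim_transform_eventually)
  then have evF: "\<forall>\<^sub>F w in at_infinity. dist (F w - w) 1 < 1/4"
    by (rule tendstoD) simp
  have "((\<lambda>w. of_nat m * Ln (1 + x w)) \<longlongrightarrow> of_nat m * Ln (1 + 0)) at_infinity"
    by (intro tendsto_intros xlim) auto
  then have evL: "\<forall>\<^sub>F w in at_infinity. norm (of_nat m * Ln (1 + x w)) < 1"
    using order_tendstoD(2)[OF tendsto_norm, of _ 0 _ 1] by simp
  have "\<forall>\<^sub>F w in at_infinity. norm (\<eta> w) < e \<and> norm (x w) < 1/2 \<and> dist (F w - w) 1 < 1/4 \<and>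
      norm (of_nat m * Ln (1 + x w)) < 1"
    using ev\<eta> evx evF evL by eventually_elim auto
  then obtain R0 where R0: "\<And>w. norm w \<ge> R0 \<Longrightarrow> norm (\<eta> w) < e \<and> norm (x w) < 1/2 \<and>
      dist (F w - w) 1 < 1/4 \<and> norm (of_nat m * Ln (1 + x w)) < 1"
    unfolding eventually_at_infinity by blast
  define R where "R = max R0 0"
  define H where "H = {w::complex. Re w > R}"
  have HR: "norm w \<ge> R0" "Re w > 0" "w \<noteq> 0" if "w \<in> H" for w
    using that complex_Re_le_cmod[of w] by (auto simp: H_def R_def)
  note R = R0[OF HR(1)]
  have openH: "open H" unfolding H_def by (rule open_halfspace_Re_gt)
  have convH: "convex H" unfolding H_def by (rule convex_halfspace_Re_gt)
  define \<zeta> where "\<zeta> = (\<lambda>w. z0 + \<eta> w)"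
  have \<zeta>ball: "\<zeta> w \<in> ball z0 e" if "w \<in> H" for w
    using R[OF that] by (simp add: \<zeta>_def dist_norm)
  have \<zeta>U: "poly S (\<zeta> w) \<noteq> 0 \<and> poly S (g (\<zeta> w)) \<noteq> 0" if "w \<in> H" for w
    using \<zeta>ball[OF that] e(2) e1(2) by blast
  have ReF: "Re (F w) > Re w + 3/4" if "w \<in> H" for w
  proof -
    have "\<bar>Re (F w - w - 1)\<bar> < 1/4"
      using R[OF that] abs_Re_le_cmod[of "F w - w - 1"] by (simp add: dist_norm)
    then have "Re (F w - w - 1) > - 1/4" by linarith
    then show ?thesis by simp
  qed
  have FH: "F ` H \<subseteq> H" using ReF by (force simp: H_def)
  have conj: "g (g (\<zeta> w)) = \<zeta> (F w)" if w: "w \<in> H" for w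
  proof -
    have "f (\<zeta> w) = \<eta> w ^ n * h (\<zeta> w)" using h(2)[OF \<zeta>ball[OF w]] by (simp add: \<zeta>_def)
    also have "\<dots> = \<eta> w * x w" using \<eta>pow HR[OF w] by (simp add: m x_def \<zeta>_def)
    finally have 1: "g (g (\<zeta> w)) = z0 + \<eta> w * (1 + x w)" by (simp add: f_def \<zeta>_def algebra_simps)
    have nz: "1 + x w \<noteq> 0"
    proof
      assume "1 + x w = 0"
      then have "x w = - 1" by (simp add: add_eq_0_iff)
      then show False using R[OF w] by simp
    qed
    \<comment> \<open>The imaginary part of the exponent defining \<open>F w\<close> must stay below
      \<open>pi\<close> for \<open>Ln (F w)\<close> to be that exponent. The right half plane
      contributes at most \<open>pi/2\<close> and the correction at most 1.\<close>
    have "\<bar>Im (Ln w)\<bar> < pi/2" using HR[OF w] by (intro Re_Ln_pos_lt_imp)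
    moreover have "\<bar>Im (of_nat m * Ln (1 + x w))\<bar> < 1"
      using R[OF w] abs_Im_le_cmod[of "of_nat m * Ln (1 + x w)"] by linarith
    ultimately have "\<bar>Im (Ln w - of_nat m * Ln (1 + x w))\<bar> < pi/2 + 1"
      unfolding minus_complex.sel by linarith
    then have "\<bar>Im (Ln w - of_nat m * Ln (1 + x w))\<bar> < pi" using pi_gt3 by linarith
    then have "Ln (F w) = Ln w - of_nat m * Ln (1 + x w)"
      unfolding F_def by (intro Ln_exp) linarith+
    then have "- Ln (F w) / of_nat m = - Ln w / of_nat m + Ln (1 + x w)"
      using m by (simp add: diff_divide_distrib)
    then have "exp (- Ln (F w) / of_nat m) = exp (- Ln w / of_nat m) * exp (Ln (1 + x w))"
      by (simp only: exp_add)
    also have "exp (Ln (1 + x w)) = 1 + x w" using nz by simp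
    finally have "exp (- Ln (F w) / of_nat m) = exp (- Ln w / of_nat m) * (1 + x w)" .
    then have "\<eta> (F w) = \<eta> w * (1 + x w)" by (simp add: \<eta>_def)
    then show ?thesis using 1 by (simp add: \<zeta>_def)
  qed
  have Fn: "(F ^^ k) w \<in> H \<and> Re ((F ^^ k) w) \<ge> Re w + 3/4 * real k" if "w \<in> H" for k w
  proof (induction k)
    case (Suc k)
    then have "F ((F ^^ k) w) \<in> H" using FH by blast
    then show ?case using Suc ReF[of "(F ^^ k) w"] by (simp add: field_simps)
  qed (use that in auto)
  have Fninf: "filterlim (\<lambda>k. (F ^^ k) w) at_infinity sequentially" if w: "w \<in> H" for w
    unfolding filterlim_at_infinity_conv_norm_at_top
  proof (rule filterlim_at_top_mono)
    show "filterlim (\<lambda>k. Re w + 3/4 * real k) at_top sequentially"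
      by real_asymp
    show "\<forall>\<^sub>F k in sequentially. Re w + 3/4 * real k \<le> norm ((F ^^ k) w)"
      using Fn[OF w] complex_Re_le_cmod order_trans by (intro always_eventually) blast
  qed
  have \<zeta>hol: "\<zeta> holomorphic_on H"
    unfolding \<zeta>_def \<eta>_def using HR(2) m
    by (intro holomorphic_intros) (force simp: complex_nonpos_Reals_iff)+
  define w0 where "w0 = complex_of_real (R + 1)"
  have w0: "w0 \<in> H" by (simp add: H_def w0_def)
  show ?thesis
  proof (rule basin_contains_critical_value[OF d openH convH \<zeta>hol, of z0 F w0 "\<lambda>k. Re ((F ^^ k) w0) - R"])
    show "inj_on \<zeta> H"
    proof (rule inj_onI)
      fix w w' assume w: "w \<in> H" "w' \<in> H" "\<zeta> w = \<zeta> w'"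
      then have "\<eta> w = \<eta> w'" by (simp add: \<zeta>_def)
      then have "c / w = c / w'" using \<eta>pow[OF HR(3)[OF w(1)]] \<eta>pow[OF HR(3)[OF w(2)]] by metis
      then show "w = w'" using c HR w by (simp add: field_simps)
    qed
    show "\<zeta> ` H \<subseteq> basin z0"
    proof clarify
      fix w assume w: "w \<in> H"
      have "((\<lambda>k. z0 + \<eta> ((F ^^ k) w)) \<longlongrightarrow> z0 + 0) sequentially"
        by (intro tendsto_intros filterlim_compose[OF \<eta>lim Fninf[OF w]])
      then have "(\<lambda>k. \<zeta> ((F ^^ k) w)) \<longlonglongrightarrow> z0" by (simp add: \<zeta>_def)
      then show "\<zeta> w \<in> basin z0"
        by (intro basin_via_semiconjugacy[OF z0, of H \<zeta> F]) (use \<zeta>U conj FH w in auto)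
    qed
    have contx: "continuous_on H x"
      unfolding x_def
    proof (intro continuous_intros)
      have "continuous_on H (\<lambda>w. h (\<zeta> w))"
        by (rule continuous_on_compose2[OF conth holomorphic_on_imp_continuous_on[OF \<zeta>hol]]) (use \<zeta>ball in auto)
      then show "continuous_on H (\<lambda>w. h (z0 + \<eta> w))" by (simp add: \<zeta>_def)
    qed (use HR in auto)
    show "continuous_on H F"
      unfolding F_def
    proof (intro continuous_intros contx)
      show "w \<notin> \<real>\<^sub>\<le>\<^sub>0" if "w \<in> H" for w using HR[OF that] by (auto simp: complex_nonpos_Reals_iff)
      show "1 + x w \<notin> \<real>\<^sub>\<le>\<^sub>0" if "w \<in> H" for w
        using R[OF that] abs_Re_le_cmod[of "x w"] by (auto simp: complex_nonpos_Reals_iff)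
    qed
    show "F ` H \<subseteq> H" by (rule FH)
    show "poly S (g (\<zeta> w)) \<noteq> 0 \<and> g (g (\<zeta> w)) = \<zeta> (F w)" if "w \<in> H" for w
      using \<zeta>U[OF that] conj[OF that] by blast
    show "F w0 \<noteq> w0" using ReF[OF w0] by auto
    show "Re ((F ^^ k) w0) - R > 0" for k using Fn[OF w0, of k] by (simp add: H_def)
    show "ball ((F ^^ k) w0) (Re ((F ^^ k) w0) - R) \<subseteq> H" for k
    proof
      fix z assume "z \<in> ball ((F ^^ k) w0) (Re ((F ^^ k) w0) - R)"
      then show "z \<in> H" using abs_Re_le_cmod[of "(F ^^ k) w0 - z"] by (simp add: H_def dist_norm)
    qed
    \<comment> \<open>The steps have length at most 1 + 1/4, while the distance to the boundary of
      the half plane starts at 1 and grows by at least 3/4 each time.\<close>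
    show "(\<lambda>k. dist ((F ^^ k) w0) ((F ^^ Suc k) w0) / (Re ((F ^^ k) w0) - R)) \<longlonglongrightarrow> 0"
    proof (rule tendsto_sandwich[OF _ _ tendsto_const])
      show "(\<lambda>k. (5/4) / (1 + 3/4 * real k)) \<longlonglongrightarrow> 0" by real_asymp
      show "\<forall>\<^sub>F k in sequentially. dist ((F ^^ k) w0) ((F ^^ Suc k) w0) / (Re ((F ^^ k) w0) - R) \<le> (5/4) / (1 + 3/4 * real k)"
      proof (intro always_eventually allI frac_le)
        fix k
        have "dist (F ((F ^^ k) w0) - (F ^^ k) w0) 1 < 1/4" using R Fn[OF w0, of k] by blast
        then have "norm (F ((F ^^ k) w0) - (F ^^ k) w0) \<le> 1/4 + 1"
          using norm_triangle_sub[of "F ((F ^^ k) w0) - (F ^^ k) w0" 1] by (simp add: dist_norm)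
        then show "dist ((F ^^ k) w0) ((F ^^ Suc k) w0) \<le> 5/4" by (simp add: dist_norm norm_minus_commute)
        show "1 + 3/4 * real k \<le> Re ((F ^^ k) w0) - R" using Fn[OF w0, of k] by (simp add: w0_def)
      qed auto
      show "\<forall>\<^sub>F k in sequentially. 0 \<le> dist ((F ^^ k) w0) ((F ^^ Suc k) w0) / (Re ((F ^^ k) w0) - R)"
        using Fn[OF w0] by (intro always_eventually allI divide_nonneg_nonneg) (auto simp: H_def less_imp_le)
    qed
  qed (use w0 that in auto)
qed

definition fixed_pts where "fixed_pts = {z. poly S z \<noteq> 0 \<and> r z = cnj z}"

text \<open>Basins of different fixed points are disjoint, so choosing a critical value with
  conjugate in each basin is injective. Finiteness comes from the same injection.\<close>

theorem card_nonrepelling: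
  assumes d: "degree P \<ge> 2"
  shows "finite {z \<in> fixed_pts. norm (deriv r z) \<le> 1}"
    "card {z \<in> fixed_pts. norm (deriv r z) \<le> 1} \<le> card (crit_vals P S)"
proof -
  let ?A = "{z \<in> fixed_pts. norm (deriv r z) \<le> 1}"
  have "\<exists>v. v \<in> crit_vals P S \<and> cnj v \<in> basin z" if "z \<in> ?A" for z
  proof -
    have z: "poly S z \<noteq> 0" "g z = z" using that by (auto simp: fixed_pts_def g_def)
    show ?thesis
    proof (cases "norm (deriv r z) < 1")
      case True
      show ?thesis by (rule attracting_basin_critical_value[OF d z True]) blast
    next
      case False
      then have 1: "norm (deriv r z) = 1" using that by auto
      show ?thesis by (rule parabolic_basin_critical_value[OF d z 1]) blast
    qed
  qed
  then obtain v where v: "\<And>z. z \<in> ?A \<Longrightarrow> v z \<in> crit_vals P S \<and> cnj (v z) \<in> basin z" by metis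
  have inj: "inj_on v ?A"
  proof (rule inj_onI)
    fix z z' assume "z \<in> ?A" "z' \<in> ?A" "v z = v z'"
    then show "z = z'" using v[of z] v[of z'] basin_disjoint[of "cnj (v z)" z z'] by simp
  qed
  have sub: "v ` ?A \<subseteq> crit_vals P S" using v by blast
  show "finite ?A" by (rule inj_on_finite[OF inj sub finite_crit_vals])
  show "card ?A \<le> card (crit_vals P S)" by (rule card_inj_on_le[OF inj sub finite_crit_vals])
qed

end

section \<open>Indices of continuous planar functions\<close>

text \<open>The winding number of \<open>f\<close> around \<open>e\<close>, expressed by a continuous logarithm.\<close>

definition has_index :: "(complex \<Rightarrow> complex) \<Rightarrow> complex \<Rightarrow> int \<Rightarrow> bool" where
  "has_index f e k \<longleftrightarrow> (\<exists>\<epsilon>>0. \<exists>L. continuous_on (ball e \<epsilon> - {e}) L \<and>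
      (\<forall>z\<in>ball e \<epsilon> - {e}. f z = (z - e) powi k * exp (L z)))"

text \<open>The quotient of \<open>f\<close> by its model lies in the right half plane, where
  \<open>Ln\<close> is continuous. The positive factor \<open>\<rho>\<close> admits antiholomorphic
  models: \<open>cnj (z - e)\<close> is the inverse of \<open>z - e\<close> times the square of its
  norm.\<close>

lemma has_indexI:
  assumes "\<epsilon> > 0" "c \<noteq> 0" "continuous_on (ball e \<epsilon> - {e}) f" "continuous_on (ball e \<epsilon> - {e}) \<rho>"
    and \<rho>: "\<And>z. z \<in> ball e \<epsilon> - {e} \<Longrightarrow> \<rho> z > (0::real)"
    and less: "\<And>z. z \<in> ball e \<epsilon> - {e} \<Longrightarrow> norm (1 - f z / ((z - e) powi k * of_real (\<rho> z) * c)) < 1"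
  shows "has_index f e k"
proof -
  let ?B = "ball e \<epsilon> - {e}"
  define v where "v = (\<lambda>z. f z / ((z - e) powi k * of_real (\<rho> z) * c))"
  have Rev: "Re (v z) > 0" if "z \<in> ?B" for z
  proof -
    have "\<bar>Re (1 - v z)\<bar> < 1" using less[OF that] abs_Re_le_cmod[of "1 - v z"] by (simp add: v_def)
    then show ?thesis by simp
  qed
  have contv: "continuous_on ?B v"
    unfolding v_def using assms(2) \<rho> by (intro continuous_intros assms(3,4)) force+
  define L where "L = (\<lambda>z. of_real (ln (\<rho> z)) + Ln c + Ln (v z))"
  have "continuous_on ?B L"
    unfolding L_def using Rev \<rho> by (intro continuous_intros assms(4) contv) (force simp: complex_nonpos_Reals_iff)+
  moreover have "f z = (z - e) powi k * exp (L z)" if z: "z \<in> ?B" for z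
  proof -
    have "v z \<noteq> 0" using Rev[OF z] by auto
    then have "exp (L z) = of_real (\<rho> z) * c * v z"
      using \<rho>[OF z] assms(2) by (simp add: L_def exp_add exp_of_real)
    moreover have "(z - e) powi k \<noteq> 0" using z by auto
    ultimately show ?thesis using \<rho>[OF z] assms(2) by (simp add: v_def)
  qed
  ultimately show ?thesis unfolding has_index_def using assms(1) by blast
qed

lemma has_index_mult_nonvanishing:
  assumes f: "has_index f e k" and U: "open U" "e \<in> U" "continuous_on U u" "\<And>z. z \<in> U \<Longrightarrow> u z \<noteq> 0"
  shows "has_index (\<lambda>z. f z * u z) e k"
proof -
  obtain \<epsilon> L where L: "\<epsilon> > 0" "continuous_on (ball e \<epsilon> - {e}) L"
      "\<And>z. z \<in> ball e \<epsilon> - {e} \<Longrightarrow> f z = (z - e) powi k * exp (L z)"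
    using f unfolding has_index_def by blast
  obtain \<delta> where \<delta>: "\<delta> > 0" "ball e \<delta> \<subseteq> U" using U(1,2) open_contains_ball by metis
  define \<epsilon>' where "\<epsilon>' = min \<epsilon> \<delta>"
  have "continuous_on (ball e \<epsilon>') u"
    by (rule continuous_on_subset[OF U(3)]) (use \<delta>(2) in \<open>auto simp: \<epsilon>'_def\<close>)
  then obtain h where h: "continuous_on (ball e \<epsilon>') h" "\<And>z. z \<in> ball e \<epsilon>' \<Longrightarrow> u z = exp (h z)"
  proof (rule continuous_logarithm_on_ball)
    show "u z \<noteq> 0" if "z \<in> ball e \<epsilon>'" for z using that U(4) \<delta>(2) by (auto simp: \<epsilon>'_def)
  qed blast
  show ?thesis unfolding has_index_def
  proof (intro exI[of _ \<epsilon>'] exI[of _ "\<lambda>z. L z + h z"] conjI ballI)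
    show "continuous_on (ball e \<epsilon>' - {e}) (\<lambda>z. L z + h z)"
      by (intro continuous_intros continuous_on_subset[OF L(2)] continuous_on_subset[OF h(1)]) (auto simp: \<epsilon>'_def)
    show "f z * u z = (z - e) powi k * exp (L z + h z)" if "z \<in> ball e \<epsilon>' - {e}" for z
      using L(3)[of z] h(2)[of z] that by (simp add: \<epsilon>'_def exp_add)
  qed (use L(1) \<delta>(1) in \<open>simp add: \<epsilon>'_def\<close>)
qed

text \<open>Multiplying by \<open>(z - e) powi - k * exp (- \<psi> L)\<close> with a cutoff \<open>\<psi>\<close> removes the point \<open>e\<close>
  without changing the function far away.\<close>

lemma factor_out_indices:
  assumes "finite E" "continuous_on (- E) f" "\<And>z. z \<notin> E \<Longrightarrow> f z \<noteq> 0" "\<And>e. e \<in> E \<Longrightarrow> has_index f e (k e)"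
  shows "\<exists>R K. continuous_on UNIV K \<and> (\<forall>z. norm z \<ge> R \<longrightarrow> f z = (\<Prod>e\<in>E. (z - e) powi k e) * exp (K z))"
  using assms
proof (induction E arbitrary: f rule: finite_induct)
  case empty
  have "continuous_on UNIV f" using empty by simp
  then obtain K where "continuous_on UNIV K" "\<And>z. f z = exp (K z)"
    by (rule continuous_logarithm_on_contractible) (use empty in \<open>auto intro: convex_imp_contractible\<close>)
  then show ?case by auto
next
  case (insert e E)
  obtain \<epsilon> L where L: "\<epsilon> > 0" "continuous_on (ball e \<epsilon> - {e}) L"
      "\<And>z. z \<in> ball e \<epsilon> - {e} \<Longrightarrow> f z = (z - e) powi k e * exp (L z)"
    using insert.prems(3)[of e] unfolding has_index_def by blast
  \<comment> \<open>Linear in the distance from \<open>e\<close>, equal to 1 up to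
    \<open>\<epsilon>/4\<close> and to 0 from \<open>3/4 * \<epsilon>\<close> on.\<close>
  define \<psi> where "\<psi> = (\<lambda>z. max 0 (min 1 (3/2 - 2 * dist z e / \<epsilon>)))"
  have cont\<psi>: "continuous_on X \<psi>" for X unfolding \<psi>_def by (intro continuous_intros) (use L(1) in auto)
  have \<psi>1: "\<psi> z = 1" if "dist z e \<le> \<epsilon>/4" for z
  proof -
    have "2 * dist z e / \<epsilon> \<le> 1/2" using that L(1) by (simp add: field_simps)
    then show ?thesis by (simp add: \<psi>_def)
  qed
  have \<psi>0: "\<psi> z = 0" if "dist z e \<ge> 3/4 * \<epsilon>" for z
  proof -
    have "2 * dist z e / \<epsilon> \<ge> 3/2" using that L(1) by (simp add: field_simps)
    then show ?thesis by (simp add: \<psi>_def)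
  qed
  define M where "M = (\<lambda>z. if z \<in> ball e \<epsilon> then of_real (\<psi> z) * L z else 0)"
  have contM: "continuous_on (- {e}) M"
  proof -
    have "continuous_on ((ball e \<epsilon> - {e}) \<union> - cball e (3/4 * \<epsilon>)) M"
    proof (rule continuous_on_open_Un)
      have "continuous_on (ball e \<epsilon> - {e}) (\<lambda>z. of_real (\<psi> z) * L z)"
        by (intro continuous_intros cont\<psi> L(2))
      then show "continuous_on (ball e \<epsilon> - {e}) M"
        by (rule continuous_on_eq) (auto simp: M_def)
      show "continuous_on (- cball e (3/4 * \<epsilon>)) M"
        by (rule continuous_on_eq[OF continuous_on_const[of _ 0]]) (use \<psi>0 in \<open>auto simp: M_def dist_commute\<close>)
    qed auto
    moreover have "- {e} \<subseteq> (ball e \<epsilon> - {e}) \<union> - cball e (3/4 * \<epsilon>)" using L(1) by auto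
    ultimately show ?thesis by (rule continuous_on_subset)
  qed
  define u where "u = (\<lambda>z. (z - e) powi (- k e) * exp (- M z))"
  have contu: "continuous_on (- {e}) u"
    unfolding u_def by (intro continuous_intros contM) auto
  have unz: "u z \<noteq> 0" if "z \<noteq> e" for z using that by (simp add: u_def)
  \<comment> \<open>Near \<open>e\<close> this is constantly 1, so the induction hypothesis applies
    with \<open>e\<close> removed. Far away \<open>M\<close> vanishes and only the power of
    \<open>z - e\<close> has been divided out.\<close>
  define f' where "f' = (\<lambda>z. if z = e then 1 else f z * u z)"
  have near1: "f' z = 1" if "z \<in> ball e (\<epsilon>/4)" for z
  proof (cases "z = e")
    case False
    then have "M z = L z" using that L(1) \<psi>1[of z] by (auto simp: M_def dist_commute)
    moreover have "f z = (z - e) powi k e * exp (L z)" using L(3)[of z] False that L(1) by auto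
    moreover have "(z - e) powi k e \<noteq> 0" using False by simp
    ultimately show ?thesis using False by (simp add: f'_def u_def power_int_minus exp_minus field_simps)
  qed (simp add: f'_def)
  have "\<exists>R K. continuous_on UNIV K \<and> (\<forall>z. norm z \<ge> R \<longrightarrow> f' z = (\<Prod>e\<in>E. (z - e) powi k e) * exp (K z))"
  proof (rule insert.IH)
    have "continuous_on (ball e (\<epsilon>/4) \<union> - (insert e E)) f'"
    proof (rule continuous_on_open_Un)
      show "continuous_on (ball e (\<epsilon>/4)) f'"
        by (rule continuous_on_eq[OF continuous_on_const[of _ 1]]) (simp only: near1)
      have "continuous_on (- insert e E) (\<lambda>z. f z * u z)"
        by (intro continuous_intros insert.prems continuous_on_subset[OF contu]) auto
      then show "continuous_on (- insert e E) f'" by (rule continuous_on_eq) (auto simp: f'_def)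
      show "open (- insert e E)" using insert.hyps by (intro open_Compl finite_imp_closed) auto
    qed auto
    then show "continuous_on (- E) f'" by (rule continuous_on_subset) (use L(1) in auto)
    show "f' z \<noteq> 0" if "z \<notin> E" for z using that insert.prems(2) unz by (auto simp: f'_def)
    show "has_index f' e' (k e')" if e': "e' \<in> E" for e'
    proof -
      have ne: "e' \<noteq> e" using insert.hyps e' by auto
      have "has_index (\<lambda>z. f z * u z) e' (k e')"
        by (rule has_index_mult_nonvanishing[OF _ _ _ contu]) (use insert.prems(3) e' ne unz in auto)
      then obtain \<delta> L' where L': "\<delta> > 0" "continuous_on (ball e' \<delta> - {e'}) L'"
          "\<And>z. z \<in> ball e' \<delta> - {e'} \<Longrightarrow> f z * u z = (z - e') powi k e' * exp (L' z)"
        unfolding has_index_def by blast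
      show ?thesis unfolding has_index_def
      proof (intro exI[of _ "min \<delta> (dist e' e)"] exI[of _ L'] conjI ballI)
        show "continuous_on (ball e' (min \<delta> (dist e' e)) - {e'}) L'"
          by (rule continuous_on_subset[OF L'(2)]) auto
        show "f' z = (z - e') powi k e' * exp (L' z)" if "z \<in> ball e' (min \<delta> (dist e' e)) - {e'}" for z
          using L'(3)[of z] that by (auto simp: f'_def)
      qed (use L'(1) ne in auto)
    qed
  qed
  then obtain R K where K: "continuous_on UNIV K" "\<And>z. norm z \<ge> R \<Longrightarrow> f' z = (\<Prod>e\<in>E. (z - e) powi k e) * exp (K z)"
    by blast
  show ?case
  proof (intro exI[of _ "max R (norm e + \<epsilon>)"] exI[of _ K] conjI allI impI K(1))
    fix z :: complex assume z: "norm z \<ge> max R (norm e + \<epsilon>)"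
    have "dist z e \<ge> \<epsilon>" using z norm_triangle_ineq2[of z e] by (simp add: dist_norm)
    then have "M z = 0" "z \<noteq> e" using L(1) by (auto simp: M_def dist_commute)
    then have "f z = f' z * (z - e) powi k e" by (simp add: f'_def u_def power_int_minus)
    then show "f z = (\<Prod>e\<in>insert e E. (z - e) powi k e) * exp (K z)"
      using K(2)[of z] z insert.hyps by simp
  qed
qed

text \<open>Along a large circle, \<open>G\<close> minus the obvious logarithm of the rotating
  factor takes values in the discrete set of logarithms of a constant. It is therefore constant, and
  comparing both ends of the circle gives \<open>n = 0\<close>.\<close>

lemma power_int_no_continuous_log:
  fixes G :: "complex \<Rightarrow> complex"
  assumes G: "continuous_on {z. norm z \<ge> R} G" and eq: "\<And>z. norm z \<ge> R \<Longrightarrow> z powi n = exp (G z)"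
  shows "n = 0"
proof -
  define R' where "R' = max R 1"
  have R': "R' > 0" "R' \<ge> R" by (auto simp: R'_def)
  define z where "z = (\<lambda>t::real. of_real R' * exp (2 * of_real pi * \<i> * of_real t))"
  have nz: "norm (z t) = R'" for t using R' by (simp add: z_def norm_mult)
  define h where "h = (\<lambda>t. G (z t) - (of_int n * (2 * of_real pi * \<i> * of_real t)))"
  have "continuous_on {0..1} (\<lambda>t. G (z t))"
    by (rule continuous_on_compose2[OF G]) (use R' nz in \<open>auto simp: z_def intro!: continuous_intros\<close>)
  then have conth: "continuous_on {0..1} h" unfolding h_def by (intro continuous_intros)
  have exph: "exp (h t) = of_real R' powi n" for t
  proof -
    have "exp (G (z t)) = z t powi n" using eq[of "z t"] nz R' by simp
    also have "\<dots> = of_real R' powi n * exp (of_int n * (2 * of_real pi * \<i> * of_real t))"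
      by (simp add: z_def power_int_mult_distrib exp_power_int)
    finally show ?thesis by (simp add: h_def exp_diff)
  qed
  have "h constant_on {0..1}"
  proof (rule continuous_discrete_range_constant[OF _ conth])
    show "\<exists>e>0. \<forall>y. y \<in> {0..1} \<and> h y \<noteq> h t \<longrightarrow> e \<le> norm (h y - h t)" for t
    proof (intro exI[of _ "1::real"] conjI allI impI)
      fix y assume y: "y \<in> {0..1} \<and> h y \<noteq> h t"
      have "exp (h y) = exp (h t)" by (simp add: exph)
      then obtain j :: int where j: "h y = h t + of_real (real_of_int (2 * j) * pi) * \<i>"
        unfolding exp_eq by blast
      then have "j \<noteq> 0" using y by auto
      then have "\<bar>real_of_int j\<bar> \<ge> 1" by linarith
      then have "2 * pi * 1 \<le> 2 * pi * \<bar>real_of_int j\<bar>" by (intro mult_left_mono) auto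
      moreover have "norm (h y - h t) = 2 * pi * \<bar>real_of_int j\<bar>" by (simp add: j norm_mult)
      ultimately show "1 \<le> norm (h y - h t)" using pi_gt3 by linarith
    qed simp
  qed simp
  then have "h 1 = h 0" unfolding constant_on_def by force
  moreover have "z 1 = z 0" by (simp add: z_def)
  ultimately show ?thesis by (simp add: h_def)
qed

text \<open>For large \<open>z\<close> each \<open>z - e\<close> is \<open>z\<close> times
  \<open>1 - e / z\<close>, which has positive real part and hence a continuous logarithm. So the
  power of \<open>z\<close> whose exponent is the difference of the two sides has a continuous
  logarithm near infinity.\<close>

theorem sum_of_indices:
  assumes E: "finite E" "continuous_on (- E) f" "\<And>z. z \<notin> E \<Longrightarrow> f z \<noteq> 0"
    "\<And>e. e \<in> E \<Longrightarrow> has_index f e (k e)"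
    and inf: "continuous_on {z. norm z \<ge> R0} L" "\<And>z. norm z \<ge> R0 \<Longrightarrow> f z = z powi j * exp (L z)"
  shows "j = (\<Sum>e\<in>E. k e)"
proof -
  obtain R1 K where K: "continuous_on UNIV K" "\<And>z. norm z \<ge> R1 \<Longrightarrow> f z = (\<Prod>e\<in>E. (z - e) powi k e) * exp (K z)"
    using factor_out_indices[OF E] by blast
  obtain R2 where R2: "\<And>e. e \<in> E \<Longrightarrow> norm e \<le> R2"
    using finite_imp_bounded[OF E(1)] by (auto simp: bounded_iff)
  define R where "R = max (max R0 R1) (\<bar>R2\<bar> + 1)"
  have small: "norm (e / z) < 1" if "norm z \<ge> R" "e \<in> E" for e z
  proof -
    have "norm e < norm z" using R2[OF that(2)] that(1) unfolding R_def by linarith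
    moreover from this have "norm z > 0" by (meson norm_ge_zero order_le_less_trans)
    ultimately show ?thesis by (simp add: norm_divide)
  qed
  have Re: "Re (1 - e / z) > 0" if "norm z \<ge> R" "e \<in> E" for e z
    using small[OF that] complex_Re_le_cmod[of "e / z"] by simp
  have znz: "z \<noteq> 0" if "norm z \<ge> R" for z using that by (auto simp: R_def)
  define G where "G = (\<lambda>z. (\<Sum>e\<in>E. of_int (k e) * Ln (1 - e / z)) + K z - L z)"
  have "j - (\<Sum>e\<in>E. k e) = 0"
  proof (rule power_int_no_continuous_log)
    show "continuous_on {z. norm z \<ge> R} G"
      unfolding G_def
    proof (intro continuous_intros)
      show "continuous_on {z. norm z \<ge> R} K" using K(1) by (rule continuous_on_subset) auto
      show "continuous_on {z. norm z \<ge> R} L" using inf(1) by (rule continuous_on_subset) (auto simp: R_def)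
      show "1 - e / z \<notin> \<real>\<^sub>\<le>\<^sub>0" if "e \<in> E" "z \<in> {z. norm z \<ge> R}" for e z
        using Re[of z e] that by (auto simp: complex_nonpos_Reals_iff)
    qed (use znz in auto)
    show "z powi (j - (\<Sum>e\<in>E. k e)) = exp (G z)" if z: "norm z \<ge> R" for z
    proof -
      have fac: "(z - e) powi k e = z powi k e * exp (of_int (k e) * Ln (1 - e / z))" if e: "e \<in> E" for e
      proof -
        have "1 - e / z \<noteq> 0" using Re[OF z e] by auto
        then have "exp (of_int (k e) * Ln (1 - e / z)) = (1 - e / z) powi k e"
          by (metis exp_Ln exp_power_int)
        moreover have "z - e = z * (1 - e / z)" using znz[OF z] by (simp add: field_simps)
        ultimately show ?thesis by (metis power_int_mult_distrib)
      qed
      have "(\<Prod>e\<in>E. (z - e) powi k e) = (\<Prod>e\<in>E. z powi k e) * exp (\<Sum>e\<in>E. of_int (k e) * Ln (1 - e / z))"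
        by (simp add: fac prod.distrib exp_sum E(1))
      also have "(\<Prod>e\<in>E. z powi k e) = z powi (\<Sum>e\<in>E. k e)"
        using E(1) znz[OF z] by (induction E rule: finite_induct) (auto simp: power_int_add)
      finally have "z powi j * exp (L z) = z powi (\<Sum>e\<in>E. k e) * exp (\<Sum>e\<in>E. of_int (k e) * Ln (1 - e / z)) * exp (K z)"
        using K(2)[of z] inf(2)[of z] z by (simp add: R_def)
      then show ?thesis using znz[OF z]
        by (simp add: G_def exp_add exp_diff power_int_diff field_simps)
    qed
  qed
  then show ?thesis by simp
qed

section \<open>Index count of the fixed points\<close>

lemma has_index_eventuallyI:
  assumes U: "open U" "e \<in> U" and c: "c \<noteq> 0" and f: "continuous_on (U - {e}) f"
    and \<rho>: "continuous_on (U - {e}) \<rho>" "\<And>z. z \<noteq> e \<Longrightarrow> \<rho> z > (0::real)"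
    and ev: "\<forall>\<^sub>F z in at e. norm (1 - f z / ((z - e) powi k * of_real (\<rho> z) * c)) < 1"
  shows "has_index f e k"
proof -
  obtain \<delta> where \<delta>: "\<delta> > 0" "ball e \<delta> \<subseteq> U" using U open_contains_ball by metis
  obtain \<delta>' where \<delta>': "\<delta>' > 0"
    "\<And>z. z \<noteq> e \<Longrightarrow> dist z e < \<delta>' \<Longrightarrow> norm (1 - f z / ((z - e) powi k * of_real (\<rho> z) * c)) < 1"
    using ev unfolding eventually_at by blast
  have sub: "ball e (min \<delta> \<delta>') - {e} \<subseteq> U - {e}" using \<delta>(2) by auto
  show ?thesis
    by (rule has_indexI[of "min \<delta> \<delta>'" c e f \<rho> k])
       (use \<delta> \<delta>' c \<rho> continuous_on_subset[OF f sub] continuous_on_subset[OF \<rho>(1) sub]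
        in \<open>auto simp: dist_commute\<close>)
qed

lemma has_index_nonzero:
  assumes "has_index f e k"
  obtains \<epsilon> where "\<epsilon> > 0" "\<And>z. z \<in> ball e \<epsilon> - {e} \<Longrightarrow> f z \<noteq> 0"
proof -
  obtain \<epsilon> L where "\<epsilon> > 0" "\<And>z. z \<in> ball e \<epsilon> - {e} \<Longrightarrow> f z = (z - e) powi k * exp (L z)"
    using assms unfolding has_index_def by blast
  then show ?thesis using that[of \<epsilon>] by auto
qed

lemma sum_order_roots: "(S :: complex poly) \<noteq> 0 \<Longrightarrow> (\<Sum>e | poly S e = 0. order e S) = degree S"
proof -
  assume S: "S \<noteq> 0"
  have "degree S = degree (smult (lead_coeff S) (\<Prod>z|poly S z = 0. [:-z, 1:] ^ order z S))"
    by (subst complex_poly_decompose) simp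
  also have "\<dots> = degree (\<Prod>z|poly S z = 0. [:-z, 1:] ^ order z S)" using S by simp
  also have "\<dots> = (\<Sum>z|poly S z = 0. degree ([:-z, 1:] ^ order z S))"
    by (rule degree_prod_eq_sum_degree) auto
  also have "\<dots> = (\<Sum>z|poly S z = 0. order z S)"
    by (intro sum.cong) (simp_all add: degree_power_eq)
  finally show ?thesis by simp
qed

context rat_fix_inf
begin

abbreviation defect where "defect \<equiv> (\<lambda>z. z - cnj (r z))"

lemma continuous_on_defect: "(\<And>z. z \<in> X \<Longrightarrow> poly S z \<noteq> 0) \<Longrightarrow> continuous_on X defect"
  by (intro continuous_intros rat_continuous)

lemma difference_quotient:
  assumes "poly S e \<noteq> 0"
  shows "((\<lambda>z. (r z - r e) / (z - e)) \<longlongrightarrow> deriv r e) (at e)"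
  using rat_has_field_derivative[OF assms, of P] deriv_rat[OF assms, of P]
  by (simp add: has_field_derivative_iff)

text \<open>Here \<open>z - e\<close> dominates the conjugated increment of
  \<open>r\<close>.\<close>

lemma index_attracting:
  assumes e: "e \<in> fixed_pts" and less: "norm (deriv r e) < 1"
  shows "has_index defect e 1"
proof (rule has_index_eventuallyI[OF open_poly_nonzero, of _ S 1 _ "\<lambda>_. 1"])
  have S: "poly S e \<noteq> 0" and re: "r e = cnj e" using e by (auto simp: fixed_pts_def)
  show "e \<in> {z. poly S z \<noteq> 0}" using S by simp
  show "continuous_on ({z. poly S z \<noteq> 0} - {e}) defect" by (rule continuous_on_defect) auto
  have "\<forall>\<^sub>F z in at e. norm ((r z - r e) / (z - e)) < 1"
    using order_tendstoD(2)[OF tendsto_norm[OF difference_quotient[OF S]] less] .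
  moreover have "\<forall>\<^sub>F z in at e. z \<noteq> e" by (simp add: eventually_at_filter)
  ultimately show "\<forall>\<^sub>F z in at e. norm (1 - defect z / ((z - e) powi 1 * of_real 1 * 1)) < 1"
  proof eventually_elim
    case (elim z)
    have "1 - defect z / (z - e) = cnj (r z - r e) / (z - e)"
      using elim re by (simp add: field_simps)
    then have "norm (1 - defect z / (z - e)) = norm ((r z - r e) / (z - e))"
      by (metis complex_mod_cnj norm_divide)
    then show ?case using elim by simp
  qed
qed auto

text \<open>Now the conjugated increment dominates; the model is a multiple of
  \<open>cnj (z - e)\<close>, which winds backwards.\<close>

lemma index_repelling:
  assumes e: "e \<in> fixed_pts" and gt: "norm (deriv r e) > 1"
  shows "has_index defect e (- 1)"
proof -
  have S: "poly S e \<noteq> 0" and re: "r e = cnj e" using e by (auto simp: fixed_pts_def)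
  define \<mu> where "\<mu> = deriv r e"
  have \<mu>: "norm \<mu> > 1" using gt by (simp add: \<mu>_def)
  then have \<mu>0: "\<mu> \<noteq> 0" by auto
  show ?thesis
  proof (rule has_index_eventuallyI[OF open_poly_nonzero, of _ S "- cnj \<mu>" _ "\<lambda>z. (norm (z - e))\<^sup>2"])
    show "e \<in> {z. poly S z \<noteq> 0}" using S by simp
    show "continuous_on ({z. poly S z \<noteq> 0} - {e}) defect" by (rule continuous_on_defect) auto
    have "\<forall>\<^sub>F z in at e. dist ((r z - r e) / (z - e)) \<mu> < norm \<mu> - 1"
      using tendstoD[OF difference_quotient[OF S], of "norm \<mu> - 1"] \<mu> by (simp add: \<mu>_def)
    moreover have "\<forall>\<^sub>F z in at e. z \<noteq> e" by (simp add: eventually_at_filter)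
    ultimately show "\<forall>\<^sub>F z in at e. norm (1 - defect z / ((z - e) powi (- 1) * of_real ((norm (z - e))\<^sup>2) * - cnj \<mu>)) < 1"
    proof eventually_elim
      case (elim z)
      define D where "D = (r z - r e) / (z - e)"
      have ze: "z - e \<noteq> 0" "cnj (z - e) \<noteq> 0" using elim by auto
      have rz: "r z = cnj e + D * (z - e)" using ze re by (simp add: D_def)
      have "(z - e) powi (- 1) * of_real ((norm (z - e))\<^sup>2) = cnj (z - e)"
        using ze by (simp add: complex_norm_square power_int_minus flip: of_real_power)
      then have "defect z / ((z - e) powi (- 1) * of_real ((norm (z - e))\<^sup>2) * - cnj \<mu>)
          = defect z / (cnj (z - e) * - cnj \<mu>)" by simp
      also have "\<dots> = cnj D / cnj \<mu> - (z - e) / (cnj (z - e) * cnj \<mu>)"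
        using ze \<mu>0 by (simp add: rz field_simps)
      finally have "1 - defect z / ((z - e) powi (- 1) * of_real ((norm (z - e))\<^sup>2) * - cnj \<mu>)
         = (cnj \<mu> - cnj D) / cnj \<mu> + (z - e) / (cnj (z - e) * cnj \<mu>)"
        using \<mu>0 by (simp add: field_simps)
      also have "norm \<dots> \<le> norm ((cnj \<mu> - cnj D) / cnj \<mu>) + norm ((z - e) / (cnj (z - e) * cnj \<mu>))"
        by (rule norm_triangle_ineq)
      also have "norm ((cnj \<mu> - cnj D) / cnj \<mu>) = norm (\<mu> - D) / norm \<mu>"
        by (metis complex_cnj_diff complex_mod_cnj norm_divide)
      also have "norm ((z - e) / (cnj (z - e) * cnj \<mu>)) = 1 / norm \<mu>"
        using ze by (simp add: norm_divide norm_mult del: complex_cnj_diff)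
      also have "norm (\<mu> - D) / norm \<mu> + 1 / norm \<mu> = (norm (\<mu> - D) + 1) / norm \<mu>"
        by (simp add: add_divide_distrib)
      also have "\<dots> < 1"
      proof -
        have "norm (\<mu> - D) + 1 < norm \<mu>"
          using elim by (simp add: D_def[symmetric] dist_norm norm_minus_commute)
        then show ?thesis using \<mu> by (subst divide_less_eq_1_pos) auto
      qed
      finally show ?case .
    qed
  qed (use \<mu>0 in \<open>auto intro!: continuous_intros\<close>)
qed

text \<open>The dominant term is a multiple of the power - m of \<open>cnj (z - e)\<close>, m being
  the order of the pole. Inversion and conjugation each reverse the winding, so the index is
  positive.\<close>

lemma index_pole:
  assumes e: "poly S e = 0"
  shows "has_index defect e (int (order e S))"
proof -
  define m where "m = order e S"
  have m: "m > 0" using e S_nz by (simp add: m_def order_root[symmetric] order_gt_0_iff)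
  obtain T where T: "S = [:-e, 1:] ^ m * T" "\<not> [:-e, 1:] dvd T"
    using order_decomp[OF S_nz, of e] by (auto simp: m_def)
  have Te: "poly T e \<noteq> 0" using T(2) by (simp add: poly_eq_0_iff_dvd)
  have Pe: "poly P e \<noteq> 0" using coprime_poly_common_root[OF cop] e by blast
  define u where "u = (\<lambda>z. poly P z / poly T z)"
  have ulim: "(u \<longlongrightarrow> u e) (at e)" unfolding u_def by (intro tendsto_intros Te)
  have u0: "u e \<noteq> 0" using Pe Te by (simp add: u_def)
  define U where "U = - ({z. poly S z = 0} - {e})"
  show ?thesis
  proof (rule has_index_eventuallyI[of U _ "- cnj (u e)" _ "\<lambda>z. inverse ((norm (z - e))\<^sup>2 ^ m)"])
    have "finite ({z. poly S z = 0} - {e})" using S_nz by (simp add: poly_roots_finite)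
    then show "open U" unfolding U_def by (intro open_Compl finite_imp_closed)
    show "continuous_on (U - {e}) defect" by (rule continuous_on_defect) (auto simp: U_def)
    have "((\<lambda>z. 1 - (cnj (u z) / cnj (u e) - z * cnj (z - e) ^ m / cnj (u e))) \<longlongrightarrow>
        1 - (cnj (u e) / cnj (u e) - e * cnj (e - e) ^ m / cnj (u e))) (at e)"
      using u0 by (intro tendsto_intros ulim) auto
    then have "((\<lambda>z. 1 - (cnj (u z) / cnj (u e) - z * cnj (z - e) ^ m / cnj (u e))) \<longlongrightarrow> 0) (at e)"
      using u0 m by (simp add: zero_power)
    then have "\<forall>\<^sub>F z in at e. norm (1 - (cnj (u z) / cnj (u e) - z * cnj (z - e) ^ m / cnj (u e))) < 1"
      using order_tendstoD(2)[OF tendsto_norm, of _ 0 _ 1] by force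
    moreover have "\<forall>\<^sub>F z in at e. z \<noteq> e" by (simp add: eventually_at_filter)
    ultimately show "\<forall>\<^sub>F z in at e. norm (1 - defect z / ((z - e) powi int (order e S) *
        of_real (inverse ((norm (z - e))\<^sup>2 ^ m)) * - cnj (u e))) < 1"
    proof eventually_elim
      case (elim z)
      have ze: "z - e \<noteq> 0" "cnj (z - e) \<noteq> 0" using elim by auto
      have "(z - e) ^ m * of_real (inverse ((norm (z - e))\<^sup>2 ^ m)) = inverse (cnj (z - e) ^ m)"
      proof -
        have "complex_of_real ((norm (z - e))\<^sup>2 ^ m) = ((z - e) * cnj (z - e)) ^ m"
          by (metis complex_norm_square of_real_power)
        then have "complex_of_real (inverse ((norm (z - e))\<^sup>2 ^ m)) = inverse ((z - e) ^ m * cnj (z - e) ^ m)"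
          by (metis of_real_inverse power_mult_distrib)
        then show ?thesis using ze by (simp del: complex_cnj_diff)
      qed
      then have "defect z / ((z - e) powi int (order e S) * of_real (inverse ((norm (z - e))\<^sup>2 ^ m)) * - cnj (u e))
         = defect z / (inverse (cnj (z - e) ^ m) * - cnj (u e))" by (simp add: m_def)
      also have "\<dots> = cnj (u z) / cnj (u e) - z * cnj (z - e) ^ m / cnj (u e)"
      proof -
        have "poly S z = (z - e) ^ m * poly T z" by (subst T(1)) (simp add: poly_power)
        then have rz: "r z = u z / (z - e) ^ m" by (simp add: rat_def u_def)
        show ?thesis unfolding rz using ze u0 by (simp add: field_simps del: complex_cnj_diff)
      qed
      finally show ?case using elim by simp
    qed
  qed (use u0 in \<open>auto intro!: continuous_intros simp: U_def\<close>)
qed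

end

text \<open>The multiplier of \<open>r\<close> at infinity is \<open>lead_coeff S / lead_coeff P\<close>.\<close>

locale rat_repelling_inf = rat_fix_inf +
  assumes deg_Suc: "degree P = Suc (degree S)" and lc_less: "norm (lead_coeff P / lead_coeff S) < 1"
begin

lemma r_div_at_infinity: "((\<lambda>z. r z / z) \<longlongrightarrow> lead_coeff P / lead_coeff S) at_infinity"
proof -
  have "((\<lambda>x. (poly P x / x ^ degree P) / (poly S x / x ^ degree S)) \<longlongrightarrow> lead_coeff P / lead_coeff S) at_infinity"
    using S_nz by (intro tendsto_intros poly_divide_tendsto_aux) auto
  moreover have "\<forall>\<^sub>F x in at_infinity. (poly P x / x ^ degree P) / (poly S x / x ^ degree S) = r x / x"
    by (rule eventually_at_infinityI[of 1]) (auto simp: deg_Suc rat_def)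
  ultimately show ?thesis by (rule Lim_transform_eventually)
qed

lemma near_infinity:
  obtains R where "R \<ge> 1" "\<And>z. norm z \<ge> R \<Longrightarrow> poly S z \<noteq> 0 \<and> norm (r z / z) < 1"
proof -
  have "\<forall>\<^sub>F z in at_infinity. norm (r z / z) < 1"
    using order_tendstoD(2)[OF tendsto_norm[OF r_div_at_infinity] lc_less] .
  then obtain R1 where R1: "\<And>z. norm z \<ge> R1 \<Longrightarrow> norm (r z / z) < 1"
    unfolding eventually_at_infinity by blast
  have "bounded {z. poly S z = 0}" using S_nz by (intro finite_imp_bounded poly_roots_finite)
  then obtain R2 where R2: "\<And>z. poly S z = 0 \<Longrightarrow> norm z \<le> R2" by (auto simp: bounded_iff)
  show ?thesis
  proof (rule that[of "max 1 (max R1 (R2 + 1))"])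
    fix z :: complex assume z: "norm z \<ge> max 1 (max R1 (R2 + 1))"
    show "poly S z \<noteq> 0 \<and> norm (r z / z) < 1"
      using R1[of z] R2[of z] z by (auto simp del: norm_divide)
  qed simp
qed

text \<open>The winding number of \<open>defect\<close> at infinity is 1 and the poles contribute
  \<open>degree S\<close> in total. The 1 added on the left plays the part of the repelling fixed
  point at infinity, which is not in \<open>fixed_pts\<close>.\<close>

theorem index_count:
  assumes nn: "\<And>z. z \<in> fixed_pts \<Longrightarrow> norm (deriv r z) \<noteq> 1"
  shows "finite fixed_pts"
    "card {z \<in> fixed_pts. norm (deriv r z) > 1} + 1 = card {z \<in> fixed_pts. norm (deriv r z) < 1} + degree S"
proof -
  obtain R where R: "R \<ge> 1" "\<And>z. norm z \<ge> R \<Longrightarrow> poly S z \<noteq> 0 \<and> norm (r z / z) < 1"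
    by (rule near_infinity) blast
  have Re: "Re (1 - cnj (r z) / z) > 0" if "norm z \<ge> R" for z
  proof -
    have "norm (cnj (r z) / z) < 1" using R(2)[OF that] by (simp add: norm_divide)
    then show ?thesis using complex_Re_le_cmod[of "cnj (r z) / z"] by simp
  qed
  have znz: "z \<noteq> 0" if "norm z \<ge> R" for z using that R(1) by auto
  have defect_inf: "defect z = z * (1 - cnj (r z) / z)" if "norm z \<ge> R" for z
    using znz[OF that] by (simp add: field_simps)
  define k where "k = (\<lambda>e. if poly S e = 0 then int (order e S) else if norm (deriv r e) < 1 then 1 else - 1)"
  have ind: "has_index defect e (k e)" if "e \<in> fixed_pts \<union> {z. poly S z = 0}" for e
  proof (cases "poly S e = 0")
    case True
    then show ?thesis using index_pole by (simp add: k_def)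
  next
    case False
    then have e: "e \<in> fixed_pts" using that by auto
    then show ?thesis
      using index_attracting[OF e] index_repelling[OF e] nn[OF e] False by (auto simp: k_def)
  qed
  have defect0: "defect z = 0 \<longleftrightarrow> r z = cnj z" for z
    by (metis complex_cnj_cnj right_minus_eq)
  have fix0: "defect z = 0" if "z \<in> fixed_pts" for z using that by (auto simp: fixed_pts_def)
  have nlim: "\<not> e islimpt fixed_pts" for e
  proof
    assume lim: "e islimpt fixed_pts"
    have "\<exists>\<epsilon>>0. \<forall>z\<in>ball e \<epsilon> - {e}. defect z \<noteq> 0"
    proof (cases "e \<in> fixed_pts \<union> {z. poly S z = 0}")
      case True
      show ?thesis by (rule has_index_nonzero[OF ind[OF True]]) blast
    next
      case False
      then have "poly S e \<noteq> 0" "defect e \<noteq> 0" unfolding defect0 by (auto simp: fixed_pts_def)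
      have "open ({z. poly S z \<noteq> 0} \<inter> defect -` (- {0}))"
        by (rule continuous_open_preimage[OF continuous_on_defect open_poly_nonzero]) auto
      moreover have "e \<in> {z. poly S z \<noteq> 0} \<inter> defect -` (- {0})"
        using \<open>poly S e \<noteq> 0\<close> \<open>defect e \<noteq> 0\<close> by simp
      ultimately obtain \<epsilon> where "\<epsilon> > 0" "ball e \<epsilon> \<subseteq> {z. poly S z \<noteq> 0} \<inter> defect -` (- {0})"
        by (rule openE)
      then show ?thesis by blast
    qed
    then obtain \<epsilon> where \<epsilon>: "\<epsilon> > 0" "\<And>z. z \<in> ball e \<epsilon> - {e} \<Longrightarrow> defect z \<noteq> 0" by blast
    obtain z where "z \<in> fixed_pts" "z \<noteq> e" "dist z e < \<epsilon>"
      using lim \<epsilon>(1) unfolding islimpt_approachable by blast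
    then show False using \<epsilon>(2)[of z] fix0[of z] by (simp add: dist_commute)
  qed
  have bdd: "fixed_pts \<subseteq> cball 0 R"
  proof
    fix z assume z: "z \<in> fixed_pts"
    have False if "norm z > R"
    proof -
      have "Re (1 - cnj (r z) / z) > 0" using Re[of z] that by simp
      then show False using defect_inf[of z] fix0[OF z] that znz[of z] by auto
    qed
    then show "z \<in> cball 0 R" by force
  qed
  have "finite (cball 0 R \<inter> fixed_pts)"
    by (rule finite_not_islimpt_in_compact) (use nlim in auto)
  then show fin: "finite fixed_pts" using bdd by (simp add: Int_absorb1)
  let ?Z = "{z. poly S z = 0}"
  have finZ: "finite ?Z" using S_nz by (rule poly_roots_finite)
  have "1 = (\<Sum>e\<in>fixed_pts \<union> ?Z. k e)"
  proof (rule sum_of_indices[of _ defect])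
    show "continuous_on (- (fixed_pts \<union> ?Z)) defect" by (rule continuous_on_defect) auto
    show "defect z \<noteq> 0" if "z \<notin> fixed_pts \<union> ?Z" for z
      using that unfolding defect0 by (auto simp: fixed_pts_def)
    show "continuous_on {z. norm z \<ge> R} (\<lambda>z. Ln (1 - cnj (r z) / z))"
    proof (intro continuous_intros rat_continuous)
      show "1 - cnj (r z) / z \<notin> \<real>\<^sub>\<le>\<^sub>0" if "z \<in> {z. norm z \<ge> R}" for z
        using Re[of z] that by (auto simp: complex_nonpos_Reals_iff)
    qed (use R(2) znz in auto)
    show "defect z = z powi 1 * exp (Ln (1 - cnj (r z) / z))" if "norm z \<ge> R" for z
    proof -
      have "1 - cnj (r z) / z \<noteq> 0" using Re[OF that] by auto
      then show ?thesis using defect_inf[OF that] by simp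
    qed
  qed (use fin finZ ind in auto)
  also have "\<dots> = (\<Sum>e\<in>fixed_pts. k e) + (\<Sum>e\<in>?Z. k e)"
    by (rule sum.union_disjoint[OF fin finZ]) (auto simp: fixed_pts_def)
  also have "(\<Sum>e\<in>?Z. k e) = int (degree S)"
    using sum_order_roots[OF S_nz] by (simp add: k_def flip: of_nat_sum)
  also have "(\<Sum>e\<in>fixed_pts. k e) = (\<Sum>e\<in>fixed_pts. if norm (deriv r e) < 1 then 1 else - 1)"
    by (intro sum.cong) (auto simp: k_def fixed_pts_def)
  also have "\<dots> = (\<Sum>e\<in>fixed_pts \<inter> {z. norm (deriv r z) < 1}. 1) + (\<Sum>e\<in>fixed_pts \<inter> - {z. norm (deriv r z) < 1}. - 1)"
    by (rule sum.If_cases[OF fin])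
  also have "fixed_pts \<inter> {z. norm (deriv r z) < 1} = {z \<in> fixed_pts. norm (deriv r z) < 1}" by auto
  also have "fixed_pts \<inter> - {z. norm (deriv r z) < 1} = {z \<in> fixed_pts. norm (deriv r z) > 1}"
    using nn by force
  finally show "card {z \<in> fixed_pts. norm (deriv r z) > 1} + 1 = card {z \<in> fixed_pts. norm (deriv r z) < 1} + degree S"
    by simp
qed

end

section \<open>Perturbation to non-neutral fixed points\<close>

text \<open>Sard's theorem in the plane. The maps \<open>\<phi>\<close> and \<open>\<psi>\<close>
  identify it with \<open>real^2\<close>, where the rank of a matrix is available.\<close>

lemma negligible_image_degenerate:
  fixes f :: "complex \<Rightarrow> complex"
  assumes f: "\<And>z. z \<in> X \<Longrightarrow> (f has_derivative f' z) (at z)"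
    and deg: "\<And>z. z \<in> X \<Longrightarrow> \<not> inj (f' z)"
  shows "negligible (f ` X)"
proof -
  define \<phi> :: "real^2 \<Rightarrow> complex" where "\<phi> = (\<lambda>x. of_real (x $ 1) + \<i> * of_real (x $ 2))"
  define \<psi> :: "complex \<Rightarrow> real^2" where "\<psi> = (\<lambda>z. Re z *\<^sub>R axis 1 1 + Im z *\<^sub>R axis 2 1)"
  have \<phi>\<psi>: "\<phi> (\<psi> z) = z" for z
    by (simp add: \<phi>_def \<psi>_def axis_def complex_eq_iff)
  have bl\<phi>: "bounded_linear \<phi>"
    unfolding \<phi>_def by (intro bounded_linear_intros bounded_linear_compose[OF bounded_linear_of_real bounded_linear_vec_nth])
  have bl\<psi>: "bounded_linear \<psi>"
    unfolding \<psi>_def by (intro bounded_linear_intros bounded_linear_Re bounded_linear_Im)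

  have "negligible ((\<lambda>x. \<psi> (f (\<phi> x))) ` (\<psi> ` X))"
  proof (rule baby_Sard[where f' = "\<lambda>x v. \<psi> (f' (\<phi> x) (\<phi> v))"])
    fix x assume "x \<in> \<psi> ` X"
    then have x: "\<phi> x \<in> X" using \<phi>\<psi> by auto
    have d1: "(f has_derivative f' (\<phi> x)) (at (\<phi> x))" by (rule f[OF x])
    have der: "((\<lambda>x. \<psi> (f (\<phi> x))) has_derivative (\<lambda>v. \<psi> (f' (\<phi> x) (\<phi> v)))) (at x)"
      by (intro bounded_linear.has_derivative[OF bl\<psi>] has_derivative_compose[OF bounded_linear_imp_has_derivative[OF bl\<phi>] d1])
    then show "((\<lambda>x. \<psi> (f (\<phi> x))) has_derivative (\<lambda>v. \<psi> (f' (\<phi> x) (\<phi> v)))) (at x within \<psi> ` X)"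
      by (rule has_derivative_at_withinI)
    have lin: "linear (\<lambda>v. \<psi> (f' (\<phi> x) (\<phi> v)))"
      using der has_derivative_linear by blast
    obtain a b where "f' (\<phi> x) a = f' (\<phi> x) b" "a \<noteq> b" using deg[OF x] by (auto simp: inj_def)
    then have "\<not> inj (\<lambda>v. \<psi> (f' (\<phi> x) (\<phi> v)))"
      by (metis \<phi>\<psi> injD)
    then have "\<not> inj ((*v) (matrix (\<lambda>v. \<psi> (f' (\<phi> x) (\<phi> v)))))"
      using matrix_vector_mul(2)[OF lin] by metis
    then show "rank (matrix (\<lambda>v. \<psi> (f' (\<phi> x) (\<phi> v)))) < CARD(2)"
      by (rule less_rank_noninjective[THEN iffD2])
  qed simp
  then have "negligible (\<phi> ` ((\<lambda>x. \<psi> (f (\<phi> x))) ` (\<psi> ` X)))"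
    by (rule negligible_differentiable_image_negligible[rotated])
       (auto intro: linear_imp_differentiable_on bounded_linear.linear[OF bl\<phi>])
  then show ?thesis by (simp add: image_image \<phi>\<psi>)
qed

context rat_fix_inf
begin

text \<open>The forbidden constants are the values of \<open>cnj z - r z\<close> at points with
  \<open>norm (deriv r z) = 1\<close>. There its real derivative is singular, so these values form a
  null set.\<close>

lemma generic_shift_no_neutral:
  assumes "\<epsilon> > 0"
  obtains c where "norm c < \<epsilon>" "\<And>z. \<lbrakk>poly S z \<noteq> 0; norm (deriv r z) = 1\<rbrakk> \<Longrightarrow> r z + c \<noteq> cnj z"
proof -
  define X where "X = {z. poly S z \<noteq> 0 \<and> norm (deriv r z) = 1}"
  define f where "f = (\<lambda>z. cnj z - r z)"
  have "negligible (f ` X)"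
  proof (rule negligible_image_degenerate)
    fix z assume z: "z \<in> X"
    have "(r has_field_derivative deriv r z) (at z)"
      using z rat_has_field_derivative[of S z P] deriv_rat[of S z P] by (simp add: X_def)
    then have "(r has_derivative (\<lambda>v. deriv r z * v)) (at z)" by (rule has_field_derivative_imp_has_derivative)
    then show "(f has_derivative (\<lambda>v. cnj v - deriv r z * v)) (at z)"
      unfolding f_def by (intro has_derivative_diff bounded_linear_imp_has_derivative bounded_linear_cnj)
    \<comment> \<open>A kernel vector: since \<open>norm v = 1\<close> and \<open>deriv r z\<close>
      is the square of \<open>cnj v\<close>, multiplying it by \<open>v\<close> gives
      \<open>cnj v\<close>.\<close>
    define v where "v = csqrt (cnj (deriv r z))"
    have v2: "v\<^sup>2 = cnj (deriv r z)" by (simp add: v_def)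
    have nv: "norm v = 1"
    proof -
      have "(norm v)\<^sup>2 = 1" using arg_cong[OF v2, of norm] z by (simp add: norm_power X_def)
      then show ?thesis using norm_ge_zero[of v] by (auto simp: power2_eq_1_iff simp del: norm_ge_zero)
    qed
    have vv: "v * cnj v = 1" using nv complex_norm_square[of v] by simp
    have "deriv r z = (cnj v)\<^sup>2" using arg_cong[OF v2, of cnj] by simp
    then have "deriv r z * v = cnj v * (v * cnj v)" by (simp add: power2_eq_square mult_ac)
    then have "cnj v - deriv r z * v = cnj 0 - deriv r z * 0" by (simp add: vv)
    moreover have "v \<noteq> 0" using nv by auto
    ultimately show "\<not> inj (\<lambda>v. cnj v - deriv r z * v)" unfolding inj_def by blast
  qed
  moreover have "\<not> negligible (ball (0::complex) \<epsilon>)" using assms by (intro open_not_negligible) auto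
  ultimately obtain c where c: "c \<in> ball 0 \<epsilon>" "c \<notin> f ` X" using negligible_subset by blast
  show ?thesis
  proof (rule that[of c])
    show "r z + c \<noteq> cnj z" if "poly S z \<noteq> 0" "norm (deriv r z) = 1" for z
    proof
      assume "r z + c = cnj z"
      then have "c = f z" by (simp add: f_def algebra_simps)
      then show False using c(2) that by (auto simp: X_def)
    qed
  qed (use c in simp)
qed

text \<open>Near a repelling point \<open>r\<close> increases distances, so \<open>defect\<close> is
  injective there and, by invariance of domain, its image contains a disc around 0. Solving
  \<open>defect z = cnj c\<close> in that disc gives the displaced fixed point.\<close>

lemma repelling_persists:
  assumes e: "e \<in> fixed_pts" "norm (deriv r e) > 1" and \<delta>: "\<delta> > 0"
  obtains \<eta> where "\<eta> > 0" "\<And>c. norm c < \<eta> \<Longrightarrow>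
    \<exists>z\<in>ball e \<delta>. poly S z \<noteq> 0 \<and> r z + c = cnj z \<and> norm (deriv r z) > 1"
proof -
  have S: "poly S e \<noteq> 0" and re: "r e = cnj e" using e by (auto simp: fixed_pts_def)
  define \<mu> where "\<mu> = deriv r e"
  define \<kappa> where "\<kappa> = (norm \<mu> - 1) / 2"
  have \<kappa>: "\<kappa> > 0" "norm \<mu> - \<kappa> > 1" using e(2) by (auto simp: \<kappa>_def \<mu>_def field_simps)
  have "continuous_on {z. poly S z \<noteq> 0} (deriv r)"
    by (intro holomorphic_on_imp_continuous_on holomorphic_deriv rat_holomorphic open_poly_nonzero)
  then have "open ({z. poly S z \<noteq> 0} \<inter> deriv r -` ball \<mu> \<kappa>)"
    by (rule continuous_open_preimage[OF _ open_poly_nonzero open_ball])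
  moreover have "e \<in> {z. poly S z \<noteq> 0} \<inter> deriv r -` ball \<mu> \<kappa>" using S \<kappa> by (simp add: \<mu>_def)
  ultimately obtain \<delta>1 where \<delta>1: "\<delta>1 > 0" "ball e \<delta>1 \<subseteq> {z. poly S z \<noteq> 0} \<inter> deriv r -` ball \<mu> \<kappa>"
    by (rule openE)
  define B where "B = ball e (min \<delta> \<delta>1)"
  have B: "poly S z \<noteq> 0" "norm (deriv r z - \<mu>) < \<kappa>" if "z \<in> B" for z
    using \<delta>1(2) that by (auto simp: B_def dist_norm norm_minus_commute)
  have expand: "norm (r z - r w) \<ge> (norm \<mu> - \<kappa>) * norm (z - w)" if zw: "z \<in> B" "w \<in> B" for z w
  proof -
    have "norm ((r z - \<mu> * z) - (r w - \<mu> * w)) \<le> \<kappa> * norm (z - w)"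
    proof (rule field_differentiable_bound[of B])
      show "((\<lambda>z. r z - \<mu> * z) has_field_derivative (deriv r x - \<mu>)) (at x within B)" if x: "x \<in> B" for x
      proof -
        have "(r has_field_derivative deriv r x) (at x)"
          using B(1)[OF x] rat_has_field_derivative[of S x P] deriv_rat[of S x P] by simp
        then have "((\<lambda>z. r z - \<mu> * z) has_field_derivative (deriv r x - \<mu> * 1)) (at x)"
          by (intro DERIV_diff DERIV_cmult DERIV_ident)
        then show ?thesis by (simp add: has_field_derivative_at_within)
      qed
    qed (use B zw in \<open>auto simp: B_def less_imp_le\<close>)
    moreover have "norm (\<mu> * (z - w)) \<le> norm (r z - r w) + norm ((r z - \<mu> * z) - (r w - \<mu> * w))"
      using norm_triangle_ineq4[of "r z - r w" "(r z - \<mu> * z) - (r w - \<mu> * w)"] by (simp add: algebra_simps)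
    ultimately show ?thesis unfolding norm_mult left_diff_distrib by linarith
  qed
  have inj: "inj_on defect B"
  proof (rule inj_onI)
    fix z w assume zw: "z \<in> B" "w \<in> B" "defect z = defect w"
    have "z - w = cnj (r z - r w)" using zw(3) by (simp add: algebra_simps)
    then have "norm (z - w) = norm (r z - r w)" by (metis complex_mod_cnj)
    then have "(norm \<mu> - \<kappa>) * norm (z - w) \<le> 1 * norm (z - w)" using expand[OF zw(1,2)] by simp
    moreover have "1 * norm (z - w) < (norm \<mu> - \<kappa>) * norm (z - w)" if "z \<noteq> w"
      using \<kappa>(2) that by (intro mult_strict_right_mono) auto
    ultimately show "z = w" by fastforce
  qed
  have "open (defect ` B)"
    by (rule invariance_of_domain[OF continuous_on_defect _ inj]) (use B in \<open>auto simp: B_def\<close>)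
  moreover have "0 \<in> defect ` B"
    using re \<delta> \<delta>1(1) by (intro image_eqI[of _ _ e]) (auto simp: B_def)
  ultimately obtain \<eta> where \<eta>: "\<eta> > 0" "ball 0 \<eta> \<subseteq> defect ` B" by (rule openE)
  show ?thesis
  proof (rule that[OF \<eta>(1)])
    fix c :: complex assume "norm c < \<eta>"
    then have "cnj c \<in> defect ` B" using \<eta>(2) by auto
    then obtain z where z: "z \<in> B" "cnj c = defect z" by blast
    have "r z + c = cnj z" using arg_cong[OF z(2), of cnj] by (simp add: algebra_simps)
    moreover have "norm (deriv r z) > 1"
      using B(2)[OF z(1)] \<kappa>(2) norm_triangle_ineq2[of \<mu> "\<mu> - deriv r z"] by (simp add: norm_minus_commute)
    ultimately show "\<exists>z\<in>ball e \<delta>. poly S z \<noteq> 0 \<and> r z + c = cnj z \<and> norm (deriv r z) > 1"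
      using z(1) B(1)[OF z(1)] by (auto simp: B_def)
  qed
qed

lemma finite_repelling_persist:
  assumes A: "finite A" "A \<subseteq> {z \<in> fixed_pts. norm (deriv r z) > 1}"
  obtains \<eta> where "\<eta> > 0" "\<And>c. norm c < \<eta> \<Longrightarrow>
    \<exists>h. inj_on h A \<and> h ` A \<subseteq> {z. poly S z \<noteq> 0 \<and> r z + c = cnj z \<and> norm (deriv r z) > 1}"
proof -
  have "\<exists>\<delta>>0. \<forall>e'\<in>A. e' \<noteq> e \<longrightarrow> \<delta> \<le> dist e e'" for e
    using finite_set_avoid[OF A(1)] by blast
  then obtain \<delta> where \<delta>: "\<And>e. \<delta> e > 0" "\<And>e e'. e' \<in> A \<Longrightarrow> e' \<noteq> e \<Longrightarrow> \<delta> e \<le> dist e e'"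
    by metis
  have "\<exists>\<eta>>0. \<forall>c. norm c < \<eta> \<longrightarrow> (\<exists>z\<in>ball e (\<delta> e / 2). poly S z \<noteq> 0 \<and> r z + c = cnj z \<and> norm (deriv r z) > 1)"
    if "e \<in> A" for e
    by (rule repelling_persists[of e "\<delta> e / 2"]) (use that A(2) \<delta>(1)[of e] in auto)
  then obtain \<eta> where \<eta>: "\<And>e. e \<in> A \<Longrightarrow> \<eta> e > 0"
    "\<And>e c. e \<in> A \<Longrightarrow> norm c < \<eta> e \<Longrightarrow> \<exists>z\<in>ball e (\<delta> e / 2). poly S z \<noteq> 0 \<and> r z + c = cnj z \<and> norm (deriv r z) > 1"
    by metis
  define m where "m = Min (insert 1 (\<eta> ` A))"
  have m: "m > 0" "\<And>e. e \<in> A \<Longrightarrow> m \<le> \<eta> e" using A(1) \<eta>(1) by (auto simp: m_def)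
  show ?thesis
  proof (rule that[OF m(1)])
    fix c :: complex assume c: "norm c < m"
    then have "\<exists>z. z \<in> ball e (\<delta> e / 2) \<and> poly S z \<noteq> 0 \<and> r z + c = cnj z \<and> norm (deriv r z) > 1"
      if "e \<in> A" for e using \<eta>(2)[OF that, of c] m(2)[OF that] by force
    then obtain h where h: "\<And>e. e \<in> A \<Longrightarrow> h e \<in> ball e (\<delta> e / 2) \<and> poly S (h e) \<noteq> 0 \<and>
        r (h e) + c = cnj (h e) \<and> norm (deriv r (h e)) > 1"
      by metis
    have "inj_on h A"
    proof (rule inj_onI, rule ccontr)
      fix e e' assume e: "e \<in> A" "e' \<in> A" "h e = h e'" "e \<noteq> e'"
      have "dist e (h e) < \<delta> e / 2" "dist e' (h e) < \<delta> e' / 2" using h[OF e(1)] h[OF e(2)] e(3) by auto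
      then have "dist e e' < \<delta> e / 2 + \<delta> e' / 2" using dist_triangle2[of e e' "h e"] by linarith
      moreover have "\<delta> e \<le> dist e e'" "\<delta> e' \<le> dist e e'"
        using \<delta>(2)[of e' e] \<delta>(2)[of e e'] e by (auto simp: dist_commute)
      ultimately show False by linarith
    qed
    then show "\<exists>h. inj_on h A \<and> h ` A \<subseteq> {z. poly S z \<noteq> 0 \<and> r z + c = cnj z \<and> norm (deriv r z) > 1}"
      using h by (intro exI[of _ h]) auto
  qed
qed

lemma rat_shift: "poly S z \<noteq> 0 \<Longrightarrow> rat (P + smult c S) S z = r z + c"
  by (simp add: rat_def add_divide_distrib)

lemma wronskian_shift: "wronskian (P + smult c S) S = wronskian P S"
  by (simp add: wronskian_def pderiv_add pderiv_smult algebra_simps)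

lemma deriv_rat_shift: "poly S z \<noteq> 0 \<Longrightarrow> deriv (rat (P + smult c S) S) z = deriv r z"
  by (simp add: deriv_rat wronskian_shift)

lemma card_crit_vals_shift: "card (crit_vals (P + smult c S) S) = card (crit_vals P S)"
proof -
  have "crit_vals (P + smult c S) S = (\<lambda>v. v + c) ` crit_vals P S"
    unfolding crit_vals_def wronskian_shift image_image by (intro image_cong) (auto simp: rat_shift)
  then show ?thesis by (simp add: card_image)
qed

end

context rat_repelling_inf
begin

lemma rat_repelling_inf_shift: "rat_repelling_inf (P + smult c S) S"
proof
  have deg: "degree (P + smult c S) = degree P"
    using deg_less by (intro degree_add_eq_left) (meson degree_smult_le order_le_less_trans)
  show "coprime (P + smult c S) S"
  proof (rule coprimeI)
    fix T assume T: "T dvd P + smult c S" "T dvd S"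
    then have "T dvd (P + smult c S) - smult c S" by (intro dvd_diff dvd_smult)
    then show "is_unit T" using T(2) cop by (auto intro: coprime_common_divisor)
  qed
  show "S \<noteq> 0" by (rule S_nz)
  show "degree S < degree (P + smult c S)" using deg deg_less by simp
  show "degree (P + smult c S) = Suc (degree S)" using deg deg_Suc by simp
  have "lead_coeff (P + smult c S) = lead_coeff P"
    using deg deg_less by (simp add: coeff_eq_0)
  then show "norm (lead_coeff (P + smult c S) / lead_coeff S) < 1" using lc_less by simp
qed

lemma card_repelling_le:
  assumes d: "degree P \<ge> 2" and A: "finite A" "A \<subseteq> {z \<in> fixed_pts. norm (deriv r z) > 1}"
  shows "card A + 1 \<le> card (crit_vals P S) + degree S"
proof -
  obtain \<eta> where \<eta>: "\<eta> > 0" "\<And>c. norm c < \<eta> \<Longrightarrow>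
      \<exists>h. inj_on h A \<and> h ` A \<subseteq> {z. poly S z \<noteq> 0 \<and> r z + c = cnj z \<and> norm (deriv r z) > 1}"
    by (rule finite_repelling_persist[OF A]) blast
  obtain c where c: "norm c < \<eta>" "\<And>z. \<lbrakk>poly S z \<noteq> 0; norm (deriv r z) = 1\<rbrakk> \<Longrightarrow> r z + c \<noteq> cnj z"
    by (rule generic_shift_no_neutral[OF \<eta>(1)]) blast
  obtain h where h: "inj_on h A" "h ` A \<subseteq> {z. poly S z \<noteq> 0 \<and> r z + c = cnj z \<and> norm (deriv r z) > 1}"
    using \<eta>(2)[OF c(1)] by blast
  interpret c: rat_repelling_inf "P + smult c S" S by (rule rat_repelling_inf_shift)
  have fp: "z \<in> c.fixed_pts \<longleftrightarrow> poly S z \<noteq> 0 \<and> r z + c = cnj z" for z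
    by (auto simp: c.fixed_pts_def rat_shift)
  have nn: "norm (deriv c.r z) \<noteq> 1" if "z \<in> c.fixed_pts" for z
    using that c(2)[of z] by (auto simp: fp deriv_rat_shift)
  have sub: "h ` A \<subseteq> {z \<in> c.fixed_pts. norm (deriv c.r z) > 1}"
    using h(2) fp deriv_rat_shift by auto
  have fin: "finite c.fixed_pts" by (rule c.index_count(1)[OF nn])
  have "card A \<le> card {z \<in> c.fixed_pts. norm (deriv c.r z) > 1}"
    by (rule card_inj_on_le[OF h(1) sub]) (use fin in auto)
  moreover have "card {z \<in> c.fixed_pts. norm (deriv c.r z) > 1} + 1
      = card {z \<in> c.fixed_pts. norm (deriv c.r z) < 1} + degree S"
    by (rule c.index_count(2)[OF nn])
  moreover have "card {z \<in> c.fixed_pts. norm (deriv c.r z) < 1} \<le> card {z \<in> c.fixed_pts. norm (deriv c.r z) \<le> 1}"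
    using fin by (intro card_mono) auto
  moreover have "card {z \<in> c.fixed_pts. norm (deriv c.r z) \<le> 1} \<le> card (crit_vals (P + smult c S) S)"
    by (rule c.card_nonrepelling(2)) (use d deg_Suc c.deg_Suc in simp)
  ultimately show ?thesis by (simp add: card_crit_vals_shift)
qed

theorem card_fixed_pts_le:
  assumes d: "degree P \<ge> 2"
  shows "finite fixed_pts" "card fixed_pts + 1 \<le> 2 * card (crit_vals P S) + degree S"
proof -
  let ?N = "{z \<in> fixed_pts. norm (deriv r z) \<le> 1}" and ?R = "{z \<in> fixed_pts. norm (deriv r z) > 1}"
  \<comment> \<open>Finiteness of the repelling set is not known in advance, and one bound on the
    shift can serve only finitely many points. The uniform bound on finite subsets gives finiteness
    and cardinality together.\<close>
  have "finite ?R \<and> card ?R \<le> card (crit_vals P S) + degree S - 1"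
    by (rule finite_if_finite_subsets_card_bdd) (use card_repelling_le[OF d] in force)
  moreover have "card (crit_vals P S) + degree S \<ge> 1" using card_repelling_le[OF d, of "{}"] by simp
  ultimately have R: "finite ?R" "card ?R + 1 \<le> card (crit_vals P S) + degree S" by auto
  have un: "fixed_pts = ?N \<union> ?R" by auto
  show "finite fixed_pts" by (subst un) (use card_nonrepelling(1)[OF d] R in auto)
  have "card fixed_pts \<le> card ?N + card ?R" by (subst un) (rule card_Un_le)
  then show "card fixed_pts + 1 \<le> 2 * card (crit_vals P S) + degree S"
    using R(2) card_nonrepelling(2)[OF d] by linarith
qed

end

section \<open>Counting critical values and moving a fixed point to infinity\<close>

lemma order_pderiv_ge:
  fixes P :: "complex poly"
  assumes "poly P e = 0" "P \<noteq> 0"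
  shows "[:-e, 1:] ^ (order e P - 1) dvd pderiv P"
proof -
  define k where "k = order e P - 1"
  have "order e P \<noteq> 0" using assms by (simp add: order_root)
  then have "[:-e, 1:] ^ Suc k dvd P" using order_1[of e P] by (simp add: k_def)
  then obtain T where "P = [:-e, 1:] ^ Suc k * T" by (rule dvdE)
  then have "pderiv P = [:-e, 1:] ^ Suc k * pderiv T + T * pderiv ([:-e, 1:] ^ Suc k)"
    by (simp only: pderiv_mult)
  also have "\<dots> = [:-e, 1:] ^ k * ([:-e, 1:] * pderiv T + T * smult (of_nat (Suc k)) (pderiv [:-e, 1:]))"
    unfolding pderiv_power_Suc by (simp add: algebra_simps del: mult_pCons_left mult_pCons_right)
  finally show ?thesis unfolding k_def by (metis dvd_triv_left)
qed

context rat_fix_inf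
begin

lemma card_crit_vals_le_degree: "card (crit_vals P S) + 1 \<le> degree P + degree S"
proof -
  have fin: "finite {z. poly (wronskian P S) z = 0}" using wronskian_degree(1) by (rule poly_roots_finite)
  have "card (crit_vals P S) \<le> card {z. poly S z \<noteq> 0 \<and> poly (wronskian P S) z = 0}"
    unfolding crit_vals_def by (rule card_image_le) (rule finite_subset[OF _ fin], auto)
  also have "\<dots> \<le> card {z. poly (wronskian P S) z = 0}" by (rule card_mono[OF fin]) auto
  also have "\<dots> \<le> degree (wronskian P S)" by (rule card_poly_roots_bound[OF wronskian_degree(1)])
  finally show ?thesis using wronskian_degree(2) deg_less by simp
qed

text \<open>A zero of \<open>r\<close> of order \<open>m\<close> is a critical point of multiplicity \<open>m - 1\<close>, but all zeros
  together contribute only the critical value \<open>0\<close>.\<close>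

lemma card_crit_vals_le_zeros: "card (crit_vals P S) \<le> degree S + card {z. poly P z = 0}"
proof -
  define W where "W = wronskian P S"
  have W: "W \<noteq> 0" "degree W = degree P + degree S - 1" using wronskian_degree by (simp_all add: W_def)
  let ?Z = "{z. poly P z = 0}" and ?R = "{z. poly W z = 0}"
  have finZ: "finite ?Z" and finR: "finite ?R" using P_nz W by (auto intro: poly_roots_finite)
  have ord: "order e P - 1 \<le> order e W" if "e \<in> ?Z" for e
  proof -
    have "[:-e, 1:] ^ (order e P - 1) dvd pderiv P" using that P_nz by (intro order_pderiv_ge) auto
    moreover have "[:-e, 1:] ^ (order e P - 1) dvd P"
      by (rule dvd_trans[OF le_imp_power_dvd order_1]) simp
    ultimately have "[:-e, 1:] ^ (order e P - 1) dvd W" unfolding W_def wronskian_def by simp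
    then show ?thesis using W(1) by (simp add: order_divides)
  qed
  have "degree P = (\<Sum>e\<in>?Z. order e P)" using sum_order_roots[OF P_nz] by simp
  also have "\<dots> \<le> (\<Sum>e\<in>?Z. order e W + 1)" using ord by (intro sum_mono) force
  also have "\<dots> = (\<Sum>e\<in>?Z. order e W) + card ?Z" by (simp only: sum.distrib sum_constant) simp
  finally have 1: "degree P \<le> (\<Sum>e\<in>?Z. order e W) + card ?Z" .
  have "card (?R - ?Z) = (\<Sum>e\<in>?R - ?Z. 1)" by simp
  also have "\<dots> \<le> (\<Sum>e\<in>?R - ?Z. order e W)"
  proof (rule sum_mono)
    fix e assume "e \<in> ?R - ?Z"
    then have "order e W \<noteq> 0" using W(1) by (simp add: order_root)
    then show "1 \<le> order e W" by simp
  qed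
  finally have 2: "card (?R - ?Z) \<le> (\<Sum>e\<in>?R - ?Z. order e W)" .
  have "degree W = (\<Sum>e\<in>?R. order e W)" using sum_order_roots[OF W(1)] by simp
  also have "\<dots> = (\<Sum>e\<in>?R \<union> ?Z. order e W)"
    using finR finZ W(1) by (intro sum.mono_neutral_left) (auto simp: order_root)
  also have "\<dots> = (\<Sum>e\<in>?R - ?Z. order e W) + (\<Sum>e\<in>?Z. order e W)"
    using finR finZ by (subst sum.union_disjoint[symmetric]) (auto intro: sum.cong)
  \<comment> \<open>Of the total multiplicity \<open>degree P + degree S - 1\<close> of
    \<open>W\<close>, the zeros of \<open>P\<close> use up at least
    \<open>degree P - card ?Z\<close>.\<close>
  finally have 3: "card (?R - ?Z) + 1 \<le> degree S + card ?Z" using 1 2 W(2) deg_less by linarith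
  have "crit_vals P S \<subseteq> insert 0 (r ` (?R - ?Z))"
    by (auto simp: crit_vals_def W_def rat_def)
  then have "card (crit_vals P S) \<le> card (insert 0 (r ` (?R - ?Z)))"
    using finR by (intro card_mono) auto
  also have "\<dots> \<le> card (?R - ?Z) + 1"
    using finR card_image_le[of "?R - ?Z" r] card_insert_le_m1 by (simp add: card_insert_if)
  finally show ?thesis using 3 by linarith
qed

end

section \<open>The coordinate that moves a fixed point to infinity\<close>

text \<open>\<open>recip_poly d b u\<close> is the polynomial \<open>w ^ d * u (b + 1 / w)\<close> in \<open>w\<close>.\<close>

definition recip_poly :: "nat \<Rightarrow> complex \<Rightarrow> complex poly \<Rightarrow> complex poly" where
  "recip_poly d b u = (\<Sum>j\<le>d. monom (coeff (pcompose u [:b, 1:]) (d - j)) j)"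

lemma coeff_recip_poly: "coeff (recip_poly d b u) j = (if j \<le> d then coeff (pcompose u [:b, 1:]) (d - j) else 0)"
  by (simp add: recip_poly_def coeff_sum coeff_monom sum.delta)

lemma degree_recip_poly: "degree (recip_poly d b u) \<le> d"
  by (rule degree_le) (simp add: coeff_recip_poly)

lemma degree_pcompose_shift: "degree (pcompose u [:b, 1:]) = degree (u :: complex poly)"
  by (simp add: degree_pcompose)

lemma poly_recip_poly:
  assumes "degree u \<le> d" "w \<noteq> 0"
  shows "poly (recip_poly d b u) w = w ^ d * poly u (b + inverse w)"
proof -
  define u1 where "u1 = pcompose u [:b, 1:]"
  have "(\<Sum>i\<le>d. monom (coeff u1 i) i) = u1"
    by (rule poly_as_sum_of_monoms') (use assms(1) in \<open>simp add: u1_def degree_pcompose_shift\<close>)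
  then have "poly u1 (inverse w) = poly (\<Sum>i\<le>d. monom (coeff u1 i) i) (inverse w)" by simp
  also have "\<dots> = (\<Sum>i\<le>d. coeff u1 i * inverse w ^ i)" unfolding poly_sum poly_monom ..
  finally have "poly u1 (inverse w) = (\<Sum>i\<le>d. coeff u1 i * inverse w ^ i)" .
  then have "w ^ d * poly u1 (inverse w) = (\<Sum>i\<le>d. coeff u1 i * w ^ (d - i))"
    using assms(2) by (simp add: sum_distrib_left power_diff field_simps power_inverse)
  also have "\<dots> = (\<Sum>j\<le>d. coeff u1 (d - j) * w ^ j)"
    by (rule sum.reindex_bij_witness[of _ "\<lambda>j. d - j" "\<lambda>j. d - j"]) auto
  also have "\<dots> = poly (recip_poly d b u) w"
    by (simp add: recip_poly_def poly_sum poly_monom u1_def)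
  finally show ?thesis by (simp add: u1_def poly_pcompose)
qed

lemma poly_recip_poly_0: "poly (recip_poly d b u) 0 = coeff (pcompose u [:b, 1:]) d"
  by (simp add: poly_0_coeff_0 coeff_recip_poly)

lemma recip_poly_0_eq_0_iff:
  assumes "degree u \<le> d" "d > 0"
  shows "poly (recip_poly d b u) 0 = 0 \<longleftrightarrow> degree u < d"
proof
  assume "poly (recip_poly d b u) 0 = 0"
  then have "coeff (pcompose u [:b, 1:]) d = 0" by (simp add: poly_recip_poly_0)
  then have "degree (pcompose u [:b, 1:]) \<noteq> d" using assms(2) by (metis leading_coeff_0_iff degree_0 less_numeral_extra(3))
  then show "degree u < d" using assms(1) by (simp add: degree_pcompose_shift)
next
  assume "degree u < d"
  then show "poly (recip_poly d b u) 0 = 0"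
    by (simp add: poly_recip_poly_0 coeff_eq_0 degree_pcompose_shift)
qed

lemma coeff_recip_poly_top: "coeff (recip_poly d b u) d = poly u b"
  by (simp add: coeff_recip_poly poly_0_coeff_0[symmetric] poly_pcompose)

text \<open>Reversal turns the Taylor coefficients of \<open>u\<close> at \<open>b\<close> into
  coefficients read from the top. This is how the multiplier at \<open>b\<close> becomes visible in
  the leading coefficients.\<close>

lemma coeff_recip_poly_subtop:
  assumes "d \<ge> 1"
  shows "coeff (recip_poly d b u) (d - 1) = poly (pderiv u) b"
proof -
  have "coeff (recip_poly d b u) (d - 1) = coeff (pderiv (pcompose u [:b, 1:])) 0"
    using assms by (simp add: coeff_recip_poly coeff_pderiv)
  also have "\<dots> = poly (pderiv (pcompose u [:b, 1:])) 0" by (simp add: poly_0_coeff_0)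
  also have "\<dots> = poly (pderiv u) b" by (simp add: pderiv_pcompose poly_pcompose pderiv_pCons)
  finally show ?thesis .
qed

lemma coprime_if_no_common_root:
  assumes "(S :: complex poly) \<noteq> 0" "\<And>z. \<not> (poly P z = 0 \<and> poly S z = 0)"
  shows "coprime P S"
proof (rule coprimeI)
  fix T assume T: "T dvd P" "T dvd S"
  then have "T \<noteq> 0" using assms(1) by auto
  moreover have "degree T = 0"
  proof (rule ccontr)
    assume "degree T \<noteq> 0"
    then obtain z where "poly T z = 0" using poly_exists_root[of T] by auto
    then have "poly P z = 0" "poly S z = 0" using T by (auto elim!: dvdE)
    then show False using assms(2) by blast
  qed
  ultimately show "is_unit T" by (simp add: is_unit_iff_degree)
qed

text \<open>In the coordinate \<open>w = 1 / (z - b)\<close> the map \<open>z \<mapsto> cnj (p z / q z)\<close> with fixed point \<open>b\<close>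
  becomes \<open>w \<mapsto> cnj (P w / S w)\<close>, which fixes infinity; the point \<open>w = 0\<close> is the old infinity.\<close>

locale fixed_to_inf =
  fixes p q :: "complex poly" and b :: complex and d :: nat
  assumes rep: "is_rat_repr p q" and d_def: "d = rat_degree p q" and d2: "d \<ge> 2"
    and b: "b \<in> finite_fixed_pts p q"
begin

text \<open>The map sends \<open>b\<close> to \<open>cnj b\<close> before conjugation, so in the new
  coordinate \<open>p / q\<close> becomes the reciprocal of \<open>p / q - cnj b\<close>, which is
  \<open>q / u\<close>. Hence \<open>P\<close> comes from \<open>q\<close> and \<open>S\<close> from
  \<open>u\<close>.\<close>

definition u where "u = p - smult (cnj b) q"

abbreviation P where "P \<equiv> recip_poly d b q"
abbreviation S where "S \<equiv> recip_poly d b u"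

lemma cop_pq: "coprime p q" and q_nz: "q \<noteq> 0"
  using rep by (auto simp: is_rat_repr_def)

lemma deg_le: "degree p \<le> d" "degree q \<le> d" "degree u \<le> d"
proof -
  show 1: "degree p \<le> d" "degree q \<le> d" by (auto simp: d_def rat_degree_def)
  then show "degree u \<le> d" unfolding u_def by (intro degree_diff_le) (auto intro: order_trans[OF degree_smult_le])
qed

lemma qb: "poly q b \<noteq> 0" and pb: "poly p b = cnj b * poly q b"
  using b by (auto simp: finite_fixed_pts_def field_simps)

lemma degree_P: "degree P = d"
  using degree_recip_poly[of d b q] le_degree[of P d] qb by (simp add: coeff_recip_poly_top)

lemma u_nz: "u \<noteq> 0"
proof
  assume "u = 0"
  then have p: "p = smult (cnj b) q" by (simp add: u_def)
  then have "q dvd p" by (simp add: dvd_smult)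
  then have "is_unit q" using cop_pq by (meson coprime_common_divisor dvd_refl)
  then have "degree q = 0" using q_nz by (simp add: is_unit_iff_degree)
  moreover from this have "degree p = 0" using p by (metis degree_smult_le le_zero_eq)
  ultimately show False using d2 by (simp add: d_def rat_degree_def)
qed

lemma S_nz: "S \<noteq> 0"
proof
  assume "S = 0"
  then have "coeff (pcompose u [:b, 1:]) i = 0" if "i \<le> d" for i
    using coeff_recip_poly[of d b u "d - i"] that by simp
  then have "pcompose u [:b, 1:] = 0"
    using deg_le(3) degree_pcompose_shift[of u b] by (metis leading_coeff_0_iff)
  then show False using u_nz by (simp add: pcompose_eq_0_iff)
qed

lemma degree_S: "degree S < degree P"
proof -
  have "coeff S d = 0" unfolding coeff_recip_poly_top by (simp add: u_def pb)
  then have "degree S \<noteq> d" using S_nz by (metis leading_coeff_0_iff)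
  then show ?thesis using degree_recip_poly[of d b u] degree_P by simp
qed

lemma poly_P: "w \<noteq> 0 \<Longrightarrow> poly P w = w ^ d * poly q (b + inverse w)"
  and poly_S: "w \<noteq> 0 \<Longrightarrow> poly S w = w ^ d * (poly p (b + inverse w) - cnj b * poly q (b + inverse w))"
  using poly_recip_poly[of q d w b] poly_recip_poly[of u d w b] deg_le by (simp_all add: u_def)

lemma degree_u: "degree q < d \<Longrightarrow> degree u = d"
proof -
  assume q: "degree q < d"
  then have p: "degree p = d" using d_def by (auto simp: rat_degree_def max_def split: if_splits)
  have "degree (smult (cnj b) q) < degree p" using q p by (meson degree_smult_le order_le_less_trans)
  then show "degree u = d" unfolding u_def diff_conv_add_uminus by (subst degree_add_eq_left) (simp_all add: p)
qed

lemma cop_PS: "coprime P S"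
proof (rule coprime_if_no_common_root[OF S_nz])
  fix w
  show "\<not> (poly P w = 0 \<and> poly S w = 0)"
  proof (cases "w = 0")
    case True
    have "\<not> (degree q < d \<and> degree u < d)" using degree_u by auto
    then show ?thesis using True recip_poly_0_eq_0_iff[of q d b] recip_poly_0_eq_0_iff[of u d b] deg_le d2 by auto
  next
    case False
    then show ?thesis using coprime_poly_common_root[OF cop_pq, of "b + inverse w"]
      by (auto simp: poly_P poly_S)
  qed
qed

sublocale rat_fix_inf P S
  by unfold_locales (rule cop_PS S_nz degree_S)+

lemma r_eq: "w \<noteq> 0 \<Longrightarrow> poly q (b + inverse w) \<noteq> 0 \<Longrightarrow> r w = inverse (rat p q (b + inverse w) - cnj b)"
proof -
  assume w: "w \<noteq> 0" and q: "poly q (b + inverse w) \<noteq> 0"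
  have "rat p q (b + inverse w) - cnj b = (poly p (b + inverse w) - cnj b * poly q (b + inverse w)) / poly q (b + inverse w)"
    using q by (simp add: rat_def field_simps)
  then show ?thesis using w by (simp add: rat_def[of P S] poly_P poly_S)
qed

lemma fixed_pts_iff:
  assumes w: "w \<noteq> 0"
  shows "w \<in> fixed_pts \<longleftrightarrow> b + inverse w \<in> finite_fixed_pts p q"
proof -
  define z where "z = b + inverse w"
  have zb: "cnj z - cnj b = inverse (cnj w)" by (simp add: z_def)
  show ?thesis
  proof
    assume "w \<in> fixed_pts"
    then have S: "poly S w \<noteq> 0" and eq: "r w = cnj w" by (auto simp: fixed_pts_def)
    have q: "poly q z \<noteq> 0"
    proof
      assume "poly q z = 0"
      then have "r w = 0" using w by (simp add: rat_def poly_P z_def)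
      then show False using eq w by simp
    qed
    have "inverse (rat p q z - cnj b) = cnj w" using r_eq[of w] w q eq by (simp add: z_def)
    then have "rat p q z - cnj b = inverse (cnj w)" by (metis inverse_inverse_eq)
    then have "rat p q z = cnj z" using zb by (metis diff_add_cancel)
    then show "b + inverse w \<in> finite_fixed_pts p q" using q by (simp add: finite_fixed_pts_def z_def rat_def)
  next
    assume "b + inverse w \<in> finite_fixed_pts p q"
    then have q: "poly q z \<noteq> 0" and eq: "rat p q z = cnj z" by (auto simp: finite_fixed_pts_def z_def rat_def)
    have rw: "r w = cnj w" using r_eq[of w] w q eq zb by (simp add: z_def)
    then have "poly S w \<noteq> 0" using w by (auto simp: rat_def)
    then show "w \<in> fixed_pts" using rw by (simp add: fixed_pts_def)
  qed
qed

text \<open>The chain rule produces the factor \<open>(cnj w / w) ^ 2\<close>: the derivative itself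
  changes, but its norm does not.\<close>

lemma norm_deriv_r:
  assumes w: "w \<noteq> 0" "w \<in> fixed_pts"
  shows "norm (deriv r w) = norm (deriv (rat p q) (b + inverse w))"
proof -
  define z where "z = b + inverse w"
  have z: "poly q z \<noteq> 0" "rat p q z = cnj z"
    using fixed_pts_iff[OF w(1)] w(2) by (auto simp: finite_fixed_pts_def z_def rat_def)
  have zb: "cnj z - cnj b = inverse (cnj w)" by (simp add: z_def)
  have dr: "(rat p q has_field_derivative deriv (rat p q) z) (at z)"
    using rat_has_field_derivative[OF z(1)] deriv_rat[OF z(1)] by metis
  define U where "U = (\<lambda>w. b + inverse w) -` {z. poly q z \<noteq> 0} \<inter> - {0}"
  have "open U"
    unfolding U_def by (subst Int_commute, rule continuous_open_preimage) (auto intro!: continuous_intros open_poly_nonzero)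
  have "((\<lambda>w. b + inverse w) has_field_derivative - (inverse w ^ 2)) (at w)"
    using w(1) by (auto intro!: derivative_eq_intros simp: power2_eq_square)
  then have "((\<lambda>w. rat p q (b + inverse w)) has_field_derivative deriv (rat p q) z * - (inverse w ^ 2)) (at w)"
    by (rule DERIV_chain2[rotated]) (use dr in \<open>simp add: z_def\<close>)
  then have "((\<lambda>w. rat p q (b + inverse w) - cnj b) has_field_derivative deriv (rat p q) z * - (inverse w ^ 2)) (at w)"
    by (auto intro!: derivative_eq_intros)
  then have "((\<lambda>w. inverse (rat p q (b + inverse w) - cnj b)) has_field_derivative
     - (inverse (rat p q z - cnj b) * (deriv (rat p q) z * - (inverse w ^ 2)) * inverse (rat p q z - cnj b))) (at w)"
    unfolding z_def
  proof (rule DERIV_inverse')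
    show "rat p q (b + inverse w) - cnj b \<noteq> 0" using z(2) zb w(1) by (simp add: z_def[symmetric])
  qed
  moreover have "w \<in> U" using w(1) z(1) by (simp add: U_def z_def)
  ultimately have "(r has_field_derivative
     - (inverse (rat p q z - cnj b) * (deriv (rat p q) z * - (inverse w ^ 2)) * inverse (rat p q z - cnj b))) (at w)"
  proof (rule has_field_derivative_transform_within_open[OF _ \<open>open U\<close>])
    show "inverse (rat p q (b + inverse x) - cnj b) = r x" if "x \<in> U" for x
      using r_eq[of x] that by (simp add: U_def)
  qed
  then have "deriv r w = - (inverse (rat p q z - cnj b) * (deriv (rat p q) z * - (inverse w ^ 2)) * inverse (rat p q z - cnj b))"
    by (rule DERIV_imp_deriv)
  also have "inverse (rat p q z - cnj b) = cnj w" using z zb by simp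
  finally show ?thesis using w(1) by (simp add: norm_mult norm_inverse norm_power z_def power2_eq_square)
qed

lemma finite_fixed_pts_eq: "finite_fixed_pts p q = insert b ((\<lambda>w. b + inverse w) ` (fixed_pts - {0}))"
proof (intro equalityI subsetI)
  fix z assume z: "z \<in> finite_fixed_pts p q"
  show "z \<in> insert b ((\<lambda>w. b + inverse w) ` (fixed_pts - {0}))"
  proof (cases "z = b")
    case False
    then have "z = b + inverse (inverse (z - b))" "inverse (z - b) \<noteq> 0" by auto
    moreover from this have "inverse (z - b) \<in> fixed_pts" using fixed_pts_iff[of "inverse (z - b)"] z by simp
    ultimately show ?thesis by blast
  qed simp
next
  fix z assume "z \<in> insert b ((\<lambda>w. b + inverse w) ` (fixed_pts - {0}))"
  then show "z \<in> finite_fixed_pts p q" using b fixed_pts_iff by auto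
qed

lemma pole_at_infinity_iff: "pole_at_infinity p q \<longleftrightarrow> degree q < d"
  by (auto simp: pole_at_infinity_def d_def rat_degree_def)

text \<open>The summand 1 is \<open>b\<close>, now at infinity. The old infinity is
  \<open>w = 0\<close>, which belongs to \<open>fixed_pts\<close> when \<open>F_hat\<close> counts
  infinity.\<close>

lemma F_hat_le:
  assumes fin: "finite fixed_pts"
  shows "finite (finite_fixed_pts p q)" "F_hat p q \<le> card fixed_pts + 1"
proof -
  show "finite (finite_fixed_pts p q)" using fin by (simp add: finite_fixed_pts_eq)
  have card: "card (finite_fixed_pts p q) \<le> card (fixed_pts - {0}) + 1"
    unfolding finite_fixed_pts_eq using fin card_image_le[of "fixed_pts - {0}" "\<lambda>w. b + inverse w"]
    by (simp add: card_insert_if)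
  show "F_hat p q \<le> card fixed_pts + 1"
  proof (cases "pole_at_infinity p q")
    case True
    then have q: "degree q < d" by (simp add: pole_at_infinity_iff)
    then have "poly P 0 = 0" "poly S 0 \<noteq> 0"
      using recip_poly_0_eq_0_iff[of q d b] recip_poly_0_eq_0_iff[of u d b] degree_u deg_le d2 by auto
    then have "0 \<in> fixed_pts" by (simp add: fixed_pts_def rat_def)
    then have "card (fixed_pts - {0}) + 1 = card fixed_pts" using fin card_Suc_Diff1 by fastforce
    then show ?thesis using card True by (simp add: F_hat_def)
  next
    case False
    have "card (fixed_pts - {0}) \<le> card fixed_pts" using fin by (intro card_mono) auto
    then show ?thesis using card False by (simp add: F_hat_def)
  qed
qed

text \<open>Poles of \<open>p / q\<close> become zeros of \<open>r\<close>, with infinity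
  corresponding to \<open>w = 0\<close>.\<close>

lemma card_zeros_le: "card {w. poly P w = 0} \<le> num_poles p q"
proof -
  have finq: "finite {z. poly q z = 0}" using q_nz by (rule poly_roots_finite)
  have P0: "poly P 0 = 0 \<longleftrightarrow> pole_at_infinity p q"
    using recip_poly_0_eq_0_iff[of q d b] deg_le d2 by (simp add: pole_at_infinity_iff)
  have "{w. poly P w = 0} \<subseteq> (\<lambda>z. inverse (z - b)) ` {z. poly q z = 0} \<union> (if pole_at_infinity p q then {0} else {})"
  proof
    fix w assume w: "w \<in> {w. poly P w = 0}"
    show "w \<in> (\<lambda>z. inverse (z - b)) ` {z. poly q z = 0} \<union> (if pole_at_infinity p q then {0} else {})"
    proof (cases "w = 0")
      case False
      then have "poly q (b + inverse w) = 0" using w by (simp add: poly_P)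
      moreover have "w = inverse (b + inverse w - b)" by simp
      ultimately show ?thesis by blast
    qed (use w P0 in auto)
  qed
  then have "card {w. poly P w = 0} \<le> card ((\<lambda>z. inverse (z - b)) ` {z. poly q z = 0} \<union> (if pole_at_infinity p q then {0} else {}))"
    using finq by (intro card_mono) auto
  also have "\<dots> \<le> card ((\<lambda>z. inverse (z - b)) ` {z. poly q z = 0}) + card (if pole_at_infinity p q then {0 :: complex} else {})"
    by (rule card_Un_le)
  also have "\<dots> \<le> num_poles p q"
    using card_image_le[OF finq] by (simp add: num_poles_def)
  finally show ?thesis .
qed

section \<open>Assembly of the two bounds\<close>

lemma card_crit_vals_bounds:
  "card (crit_vals P S) \<le> 2 * d - 2" "card (crit_vals P S) + 1 \<le> d + num_poles p q"
  using card_crit_vals_le_degree card_crit_vals_le_zeros card_zeros_le degree_S degree_P d2 by simp_all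

text \<open>A nonzero multiplier at \<open>b\<close> forces \<open>degree S = d - 1\<close>, and its
  being repelling is exactly the condition on the leading coefficients.\<close>

lemma bound_if_repelling:
  assumes rep: "norm (deriv (rat p q) b) > 1"
  shows "finite (finite_fixed_pts p q)" "F_hat p q \<le> min (3 * d + 2 * num_poles p q - 3) (5 * d - 5)"
proof -
  have der: "deriv (rat p q) b = poly (pderiv u) b / poly q b"
    using qb by (simp add: deriv_rat wronskian_def u_def pb pderiv_diff pderiv_smult power2_eq_square field_simps)
  have c: "coeff S (d - 1) = poly (pderiv u) b" using coeff_recip_poly_subtop[of d b u] d2 by simp
  have nz: "poly (pderiv u) b \<noteq> 0" using rep der by auto
  then have "degree S \<ge> d - 1" using c by (intro le_degree) simp
  then have dS: "degree S = d - 1" using degree_S degree_P by simp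
  interpret rat_repelling_inf P S
  proof
    show "degree P = Suc (degree S)" using dS degree_P d2 by simp
    have "lead_coeff P / lead_coeff S = 1 / deriv (rat p q) b"
      using der c dS degree_P by (simp add: coeff_recip_poly_top)
    then show "norm (lead_coeff P / lead_coeff S) < 1" using rep by (simp add: norm_divide divide_less_eq_1)
  qed
  have d2': "degree P \<ge> 2" using degree_P d2 by simp
  show "finite (finite_fixed_pts p q)" by (rule F_hat_le(1)[OF card_fixed_pts_le(1)[OF d2']])
  have "F_hat p q \<le> 2 * card (crit_vals P S) + degree S"
    using F_hat_le(2)[OF card_fixed_pts_le(1)[OF d2']] card_fixed_pts_le(2)[OF d2'] by linarith
  \<comment> \<open>With K critical values the count is at most 2 K + d - 1. Then K = 2 d - 2 gives
    5 d - 5, and K = d + n - 1 gives 3 d + 2 n - 3, where n is the number of poles.\<close>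
  then show "F_hat p q \<le> min (3 * d + 2 * num_poles p q - 3) (5 * d - 5)"
    using card_crit_vals_bounds dS d2 by linarith
qed

text \<open>The count is at most K + 2, where K is the number of critical values: the exceptions are
  \<open>b\<close> and the old infinity, whatever the multiplier of the latter. Both bounds on K
  leave room for the 2 because \<open>d\<close> is at least 2.\<close>

lemma bound_if_no_repelling:
  assumes nrep: "\<And>z. z \<in> finite_fixed_pts p q \<Longrightarrow> norm (deriv (rat p q) z) \<le> 1"
  shows "finite (finite_fixed_pts p q)" "F_hat p q \<le> min (3 * d + 2 * num_poles p q - 3) (5 * d - 5)"
proof -
  have d2': "degree P \<ge> 2" using degree_P d2 by simp
  have sub: "fixed_pts - {0} \<subseteq> {w \<in> fixed_pts. norm (deriv r w) \<le> 1}"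
    using nrep norm_deriv_r fixed_pts_iff by auto
  have fin0: "finite (fixed_pts - {0})" by (rule finite_subset[OF sub card_nonrepelling(1)[OF d2']])
  then have fin: "finite fixed_pts" by simp
  have "card (fixed_pts - {0}) \<le> card (crit_vals P S)"
    using card_mono[OF card_nonrepelling(1)[OF d2'] sub] card_nonrepelling(2)[OF d2'] by linarith
  moreover have "card fixed_pts \<le> card (fixed_pts - {0}) + 1"
  proof -
    have "card fixed_pts \<le> card (insert 0 (fixed_pts - {0}))" using fin by (intro card_mono) auto
    also have "\<dots> = card (fixed_pts - {0}) + 1" using fin0 by (subst card_insert_disjoint) auto
    finally show ?thesis .
  qed
  ultimately have "F_hat p q \<le> card (crit_vals P S) + 2" using F_hat_le(2)[OF fin] by linarith
  then show "F_hat p q \<le> min (3 * d + 2 * num_poles p q - 3) (5 * d - 5)"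
    using card_crit_vals_bounds d2 by linarith
  show "finite (finite_fixed_pts p q)" by (rule F_hat_le(1)[OF fin])
qed

end

text \<open>Finiteness is asserted together with the bound because \<open>card\<close> of an
  infinite set is 0.\<close>

theorem mainTheorem5:
  fixes p q :: "complex poly" and d n :: nat
  assumes "is_rat_repr p q"
    and "d = rat_degree p q" and "d \<ge> 2"
    and "n = num_poles p q"
  shows "finite (finite_fixed_pts p q) \<and> F_hat p q \<le> min (3*d + 2*n - 3) (5*d - 5)"
proof (cases "finite_fixed_pts p q = {}")
  case True
  then show ?thesis using assms(3) by (auto simp: F_hat_def)
next
  case False
  show ?thesis
  proof (cases "\<exists>z\<in>finite_fixed_pts p q. norm (deriv (rat p q) z) > 1")
    case True
    then obtain b where b0: "b \<in> finite_fixed_pts p q" "norm (deriv (rat p q) b) > 1" by blast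
    interpret fixed_to_inf p q b d by unfold_locales (use assms b0 in auto)
    show ?thesis using bound_if_repelling[OF b0(2)] assms(4) by simp
  next
    case nrep: False
    obtain b where b0: "b \<in> finite_fixed_pts p q" using False by blast
    interpret fixed_to_inf p q b d by unfold_locales (use assms b0 in auto)
    have "norm (deriv (rat p q) z) \<le> 1" if "z \<in> finite_fixed_pts p q" for z
      using nrep that by force
    then show ?thesis using bound_if_no_repelling assms(4) by blast
  qed
qed

end
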